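(* For $0<|q|<1$, \begin{align*} \overline{r}_0(1)&=\frac{J_{6}^{12}}{3J_{1,6}^7J_{2}^4J_{3,6}^2}+\frac{4J_{6}^3}{3J_{1,6}J_{2}}+\frac{J_{1,6}^5J_2^2J_{3,6}^2}{3J_{6}^6},\\ \overline{r}_1(1)&=\frac{J_{6}^{12}}{3J_{1,6}^7J_{2}^4J_{3,6}^2}-\frac{J_{1,6}^5J_2^2J_{3,6}^2}{3J_{6}^6},\\ \overline{r}_2(1)&=\frac{J_{6}^{12}}{3J_{1,6}^7J_{2}^4J_{3,6}^2}-\frac{2J_{6}^3}{3J_{1,6}J_{2}}+\frac{J_{1,6}^5J_2^2J_{3,6}^2}{3J_{6}^6},\\ \overline{r}_3(1)&=\frac{J_{6}^{12}}{3J_{1,6}^7J_{2}^4J_{3,6}^2}-\frac{J_{1,6}^5J_2^2J_{3,6}^2}{3J_{6}^6}. \end{align*}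
   Context: An overpartition of a non-negative integer $n$ is a partition of $n$ in which the first occurrence of each distinct part may be overlined; the empty overpartition of $0$ is counted and has rank $0$. The rank of an overpartition is its largest part minus its number of parts. $\overline N(s,6,n)$ is the number of overpartitions of $n$ with rank congruent to $s$ modulo $6$, and $\overline r_s(d)=\sum_{n\ge0}\overline N(s,6,3n+d)q^n$. Notation: $(a;q)_\infty=\prod_{n\ge0}(1-aq^n)$, $j(z;q)=(z;q)_\infty(q/z;q)_\infty(q;q)_\infty$, $J_{a,m}=j(q^a;q^m)$, $J_m=(q^m;q^m)_\infty$. *)

theory Defs
  imports
    "HOL-Analysis.Analysis"
    "HOL-Library.Multiset"
    "HOL-Number_Theory.Cong"
begin

text \<open>
  An overpartition is encoded as a pair \<open>(P, S)\<close>: the underlying partition \<open>P\<close>, a multiset of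
  positive integers, and the set \<open>S\<close> of those part sizes whose first occurrence is overlined.
\<close>

type_synonym overpartition = "nat multiset \<times> nat set"

definition overpartitions :: "nat \<Rightarrow> overpartition set" where
  "overpartitions n =
     {(P, S). (\<forall>k \<in># P. k > 0) \<and> sum_mset P = n \<and> S \<subseteq> set_mset P}"

definition overpartition_rank :: "overpartition \<Rightarrow> int" where
  "overpartition_rank \<pi> =
     (if fst \<pi> = {#} then 0
      else int (Max (set_mset (fst \<pi>))) - int (size (fst \<pi>)))"

definition Nbar :: "int \<Rightarrow> nat \<Rightarrow> nat \<Rightarrow> nat" where
  "Nbar s l n = card {\<pi> \<in> overpartitions n. [overpartition_rank \<pi> = s] (mod int l)}"

definition rbar_term :: "int \<Rightarrow> nat \<Rightarrow> complex \<Rightarrow> nat \<Rightarrow> complex" where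
  "rbar_term s d q n = of_nat (Nbar s 6 (3 * n + d)) * q ^ n"

definition rbar :: "int \<Rightarrow> nat \<Rightarrow> complex \<Rightarrow> complex" where
  "rbar s d q = (\<Sum>n. rbar_term s d q n)"

definition qpoch_inf :: "complex \<Rightarrow> complex \<Rightarrow> complex" where
  "qpoch_inf a q = (\<Prod>n. 1 - a * q ^ n)"

definition theta_j :: "complex \<Rightarrow> complex \<Rightarrow> complex" where
  "theta_j z q = qpoch_inf z q * qpoch_inf (q / z) q * qpoch_inf q q"

text \<open>The nome \<open>q\<close>, implicit in \<open>J\<^sub>a\<^sub>,\<^sub>m\<close> and \<open>J\<^sub>m\<close>, is the last argument of \<open>J_am\<close> and \<open>J_m\<close>.\<close>

definition J_am :: "nat \<Rightarrow> nat \<Rightarrow> complex \<Rightarrow> complex" where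
  "J_am a m q = theta_j (q ^ a) (q ^ m)"

definition J_m :: "nat \<Rightarrow> complex \<Rightarrow> complex" where
  "J_m m q = qpoch_inf (q ^ m) (q ^ m)"

text \<open>The sets counted by \<^const>\<open>Nbar\<close> are finite, so \<^const>\<open>card\<close> is the true count.\<close>

lemma finite_overpartitions: "finite (overpartitions n)"
proof -
  let ?L = "{xs :: nat list. set xs \<subseteq> {..n} \<and> length xs \<le> n}"
  have size_le: "size P \<le> sum_mset P" if "\<forall>k \<in># P. k > 0" for P :: "nat multiset"
    using that by (induction P) auto
  have "overpartitions n \<subseteq> (mset ` ?L) \<times> Pow {..n}"
  proof
    fix \<pi> assume "\<pi> \<in> overpartitions n"
    then obtain P S where \<pi>: "\<pi> = (P, S)" and pos: "\<forall>k \<in># P. k > 0"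
      and sum: "sum_mset P = n" and S: "S \<subseteq> set_mset P"
      by (auto simp: overpartitions_def)
    obtain xs where xs: "mset xs = P" using ex_mset by blast
    have le: "k \<le> n" if "k \<in># P" for k
      using that sum by (metis sum_mset.remove le_add1)
    have "xs \<in> ?L"
      using le xs size_le[OF pos] sum by (auto simp flip: size_mset set_mset_mset)
    with xs S le show "\<pi> \<in> (mset ` ?L) \<times> Pow {..n}" by (auto simp: \<pi>)
  qed
  moreover have "finite ?L" by (rule finite_lists_length_le) simp
  ultimately show ?thesis by (meson finite_SigmaI finite_Pow_iff finite_atMost finite_imageI finite_subset)
qed

end

theory Submission
  imports Defs "HOL-Complex_Analysis.Complex_Analysis"
begin

text \<open>
  Sorting overpartitions by their largest part gives, for \<open>|x| = 1\<close>, the generating function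
  \<open>R(x; q) = 1 + 2 \<Sum>\<^sub>m q\<^sup>m\<^sup>+\<^sup>1 x\<^sup>-\<^sup>m (-qx; q)\<^sub>m / (qx; q)\<^sub>m\<^sub>+\<^sub>1\<close> of \<open>x\<close> to the power \<open>- rank\<close>; the right-hand
  side is meromorphic in \<open>|x| > |q|\<close>. The function \<open>E(x) = (1 + x) / (1 - x) R(x; q)\<close> satisfies
  \<open>E(qx) = 1 - qx\<^sup>2 - qx\<^sup>2 E(x)\<close>. Iterating three times, with \<open>Q = q\<^sup>3\<close>,
  \<open>E(Qx) = 1 - 2q\<^sup>5x\<^sup>2 + 2q\<^sup>8x\<^sup>4 - q\<^sup>9x\<^sup>6 - q\<^sup>9x\<^sup>6 E(x)\<close>, and no power of \<open>q\<close> in the polynomial part is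
  congruent to 1 modulo 3. Hence the part \<open>E\<^sub>1\<close> of \<open>E\<close> carrying the exponents 1 modulo 3, obtained by
  averaging over \<open>q \<mapsto> \<omega>q\<close> for a primitive cube root of unity \<open>\<omega>\<close>, satisfies the homogeneous equation
  \<open>E\<^sub>1(Qx) = - Q\<^sup>3x\<^sup>6 E\<^sub>1(x)\<close>. Its poles are cancelled by \<open>j(x\<^sup>3; Q)\<close>, and
  \<open>E\<^sub>1(x) j(x\<^sup>3; Q) / (j(\<omega>x; Q) j(\<omega>\<^sup>2x; Q) j(-x; Q))\<close> is holomorphic and invariant under \<open>x \<mapsto> Qx\<close>,
  so it is constant. At \<open>x = 1/q\<close> only one of the three conjugates of \<open>q\<close> contributes, which
  determines the constant; the values at the sixth roots of unity give the residue classes modulo 6.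
\<close>

section \<open>Infinite \<open>q\<close>-products\<close>

definition qpoch :: "complex \<Rightarrow> complex \<Rightarrow> nat \<Rightarrow> complex" where
  "qpoch a q m = (\<Prod>k<m. 1 - a * q ^ k)"

lemma qpoch_0 [simp]: "qpoch a q 0 = 1"
  by (simp add: qpoch_def)

lemma qpoch_Suc: "qpoch a q (Suc m) = qpoch a q m * (1 - a * q ^ m)"
  by (simp add: qpoch_def)

lemma qpoch_Suc_shift: "qpoch a q (Suc m) = (1 - a) * qpoch (a * q) q m"
  unfolding qpoch_def by (subst prod.lessThan_Suc_shift) (simp add: mult_ac)

lemma convergent_prod_qpoch:
  fixes a q :: complex
  assumes "norm q < 1"
  shows "convergent_prod (\<lambda>n. 1 - a * q ^ n)"
proof (intro abs_convergent_prod_imp_convergent_prod summable_imp_abs_convergent_prod)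
  have "summable (\<lambda>n. norm a * norm q ^ n)"
    using assms by (intro summable_mult summable_geometric) simp
  then show "summable (\<lambda>n. norm (1 - a * q ^ n - 1))"
    by (simp add: norm_mult norm_power)
qed

lemma qpoch_tendsto:
  assumes "norm q < 1"
  shows "qpoch a q \<longlonglongrightarrow> qpoch_inf a q"
proof -
  have "(\<lambda>n. \<Prod>i\<le>n. 1 - a * q ^ i) \<longlonglongrightarrow> qpoch_inf a q"
    unfolding qpoch_inf_def by (intro convergent_prod_LIMSEQ convergent_prod_qpoch assms)
  then have "(\<lambda>n. qpoch a q (Suc n)) \<longlonglongrightarrow> qpoch_inf a q"
    by (simp add: qpoch_def lessThan_Suc_atMost)
  then show ?thesis by (simp add: filterlim_sequentially_Suc)
qed

lemma qpoch_inf_step: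
  assumes "norm q < 1"
  shows "qpoch_inf a q = (1 - a) * qpoch_inf (a * q) q"
proof (rule LIMSEQ_unique)
  show "(\<lambda>m. qpoch a q (Suc m)) \<longlonglongrightarrow> qpoch_inf a q"
    using qpoch_tendsto[OF assms] by (simp add: filterlim_sequentially_Suc)
  show "(\<lambda>m. qpoch a q (Suc m)) \<longlonglongrightarrow> (1 - a) * qpoch_inf (a * q) q"
    unfolding qpoch_Suc_shift by (intro tendsto_intros qpoch_tendsto assms)
qed

lemma qpoch_inf_split:
  assumes "norm q < 1"
  shows "qpoch_inf a q = qpoch a q m * qpoch_inf (a * q ^ m) q"
proof (induction m)
  case (Suc m)
  then show ?case
    using qpoch_inf_step[OF assms, of "a * q ^ m"] by (simp add: qpoch_Suc mult_ac)
qed simp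

lemma qpoch_inf_nonzero:
  assumes "norm q < 1" and "\<And>n. a * q ^ n \<noteq> 1"
  shows "qpoch_inf a q \<noteq> 0"
  unfolding qpoch_inf_def
  by (intro prodinf_nonzero convergent_prod_qpoch assms(1)) (use assms(2) in auto)

lemma qpoch_inf_nonzero_norm:
  assumes "norm q < 1" and "norm a < 1"
  shows "qpoch_inf a q \<noteq> 0"
proof (rule qpoch_inf_nonzero[OF assms(1)])
  fix n
  have "norm (a * q ^ n) \<le> norm a * 1"
    unfolding norm_mult norm_power using assms by (intro mult_left_mono power_le_one) auto
  then show "a * q ^ n \<noteq> 1" using assms(2) by force
qed

lemma qpoch_inf_1 [simp]: "norm q < 1 \<Longrightarrow> qpoch_inf 1 q = 0"
  by (subst qpoch_inf_step) auto

lemma qpoch_inf_square: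
  assumes "norm q < 1"
  shows "qpoch_inf a q * qpoch_inf (- a) q = qpoch_inf (a ^ 2) (q ^ 2)"
proof (rule LIMSEQ_unique)
  have "norm (q ^ 2) < 1" using assms by (simp add: norm_power power_less_one_iff)
  then show "(\<lambda>m. qpoch (a ^ 2) (q ^ 2) m) \<longlonglongrightarrow> qpoch_inf (a ^ 2) (q ^ 2)"
    by (rule qpoch_tendsto)
  have "qpoch (a ^ 2) (q ^ 2) m = qpoch a q m * qpoch (- a) q m" for m
    unfolding qpoch_def prod.distrib [symmetric]
    by (intro prod.cong refl) (simp add: power2_eq_square algebra_simps power_mult_distrib)
  moreover have "(\<lambda>m. qpoch a q m * qpoch (- a) q m) \<longlonglongrightarrow> qpoch_inf a q * qpoch_inf (- a) q"
    by (intro tendsto_intros qpoch_tendsto assms)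
  ultimately show "(\<lambda>m. qpoch (a ^ 2) (q ^ 2) m) \<longlonglongrightarrow> qpoch_inf a q * qpoch_inf (- a) q"
    by simp
qed

text \<open>Holds factor by factor. It links the nome \<open>q\<close> with the nome
  \<open>q ^ 3\<close>, which all three conjugates \<open>w ^ j * q\<close> share.\<close>

lemma qpoch_inf_cube:
  assumes "norm q < 1" and w: "w ^ 2 + w + 1 = (0::complex)"
  shows "qpoch_inf a q * qpoch_inf (w * a) q * qpoch_inf (w ^ 2 * a) q = qpoch_inf (a ^ 3) (q ^ 3)"
proof (rule LIMSEQ_unique)
  have "norm (q ^ 3) < 1" using assms(1) by (simp add: norm_power power_less_one_iff)
  then show "(\<lambda>m. qpoch (a ^ 3) (q ^ 3) m) \<longlonglongrightarrow> qpoch_inf (a ^ 3) (q ^ 3)"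
    by (rule qpoch_tendsto)
  have *: "(1 - y) * (1 - w * y) * (1 - w ^ 2 * y) = 1 - y ^ 3" for y
    using w by algebra
  have "qpoch (a ^ 3) (q ^ 3) m = qpoch a q m * qpoch (w * a) q m * qpoch (w ^ 2 * a) q m" for m
    unfolding qpoch_def prod.distrib [symmetric]
  proof (intro prod.cong refl)
    fix k
    show "1 - a ^ 3 * (q ^ 3) ^ k = (1 - a * q ^ k) * (1 - w * a * q ^ k) * (1 - w\<^sup>2 * a * q ^ k)"
      using *[of "a * q ^ k"]
      by (simp add: power_mult_distrib mult.assoc flip: power_mult) (simp add: mult_ac)
  qed
  moreover have "(\<lambda>m. qpoch a q m * qpoch (w * a) q m * qpoch (w ^ 2 * a) q m)
      \<longlonglongrightarrow> qpoch_inf a q * qpoch_inf (w * a) q * qpoch_inf (w ^ 2 * a) q"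
    by (intro tendsto_intros qpoch_tendsto assms)
  ultimately show "(\<lambda>m. qpoch (a ^ 3) (q ^ 3) m)
      \<longlonglongrightarrow> qpoch_inf a q * qpoch_inf (w * a) q * qpoch_inf (w ^ 2 * a) q"
    by simp
qed

text \<open>Sort the exponents by residue modulo \<open>k\<close>: this is exact for finite products
  of length \<open>k * m\<close>, and passing to a subsequence keeps the limit.\<close>

lemma qpoch_inf_dissect:
  assumes "norm q < 1" and "k > 0"
  shows "qpoch_inf a q = (\<Prod>i<k. qpoch_inf (a * q ^ i) (q ^ k))"
proof (rule LIMSEQ_unique)
  have "norm (q ^ k) < 1" using assms by (simp add: norm_power power_less_one_iff)
  then show "(\<lambda>m. \<Prod>i<k. qpoch (a * q ^ i) (q ^ k) m) \<longlonglongrightarrow> (\<Prod>i<k. qpoch_inf (a * q ^ i) (q ^ k))"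
    by (intro tendsto_intros qpoch_tendsto)
  have "qpoch a q (k * m) = (\<Prod>i<k. qpoch (a * q ^ i) (q ^ k) m)" for m
  proof (induction m)
    case (Suc m)
    have "qpoch a q (k * m + j) = qpoch a q (k * m) * (\<Prod>i<j. 1 - a * q ^ (k * m + i))" for j
      by (induction j) (simp_all add: qpoch_Suc mult_ac)
    from this[of k] Suc show ?case
      by (simp add: qpoch_Suc prod.distrib power_add power_mult mult_ac add.commute)
  qed simp
  moreover have "(\<lambda>m. qpoch a q (k * m)) \<longlonglongrightarrow> qpoch_inf a q"
    using LIMSEQ_subseq_LIMSEQ[OF qpoch_tendsto[OF assms(1), of a], of "\<lambda>m. k * m"] assms(2)
    by (simp add: o_def strict_mono_def)
  ultimately show "(\<lambda>m. \<Prod>i<k. qpoch (a * q ^ i) (q ^ k) m) \<longlonglongrightarrow> qpoch_inf a q"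
    by simp
qed

section \<open>Uniform bounds and holomorphy of the products\<close>

lemma norm_qpoch_le:
  assumes "norm q < 1"
  shows "norm (qpoch a q m) \<le> exp (norm a / (1 - norm q))"
proof -
  have "norm (qpoch a q m) \<le> (\<Prod>k<m. exp (norm a * norm q ^ k))"
    unfolding qpoch_def prod_norm [symmetric]
  proof (intro prod_mono conjI norm_ge_zero)
    fix k
    have "norm (1 - a * q ^ k) \<le> 1 + norm a * norm q ^ k"
      by (metis norm_mult norm_one norm_power norm_triangle_ineq4)
    also have "\<dots> \<le> exp (norm a * norm q ^ k)" by (rule exp_ge_add_one_self)
    finally show "norm (1 - a * q ^ k) \<le> exp (norm a * norm q ^ k)" .
  qed
  also have "\<dots> = exp (norm a * (\<Sum>k<m. norm q ^ k))"
    by (simp add: exp_sum sum_distrib_left)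
  also have "(\<Sum>k<m. norm q ^ k) \<le> 1 / (1 - norm q)"
    using assms sum_le_suminf[of "\<lambda>k. norm q ^ k" "{..<m}"]
    by (simp add: summable_geometric suminf_geometric)
  then have "exp (norm a * (\<Sum>k<m. norm q ^ k)) \<le> exp (norm a / (1 - norm q))"
    using mult_left_mono[of "\<Sum>k<m. norm q ^ k" "1 / (1 - norm q)" "norm a"] by simp
  finally show ?thesis .
qed

lemma norm_qpoch_inf_le:
  assumes "norm q < 1"
  shows "norm (qpoch_inf a q) \<le> exp (norm a / (1 - norm q))"
  by (rule LIMSEQ_le_const2[OF tendsto_norm[OF qpoch_tendsto[OF assms]]])
    (use norm_qpoch_le[OF assms] in blast)

lemma holomorphic_qpoch [holomorphic_intros]:
  assumes "f holomorphic_on S"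
  shows "(\<lambda>z. qpoch (f z) q m) holomorphic_on S"
  unfolding qpoch_def by (intro holomorphic_intros assms)

lemma holomorphic_qpoch_inf_aux:
  assumes "norm q < 1"
  shows "(\<lambda>z. qpoch_inf z q) holomorphic_on UNIV"
proof (rule holomorphic_uniform_sequence)
  show "(\<lambda>z. qpoch z q m) holomorphic_on UNIV" for m
    by (intro holomorphic_intros)
  fix x :: complex
  \<comment> \<open>On the unit disc around \<open>x\<close> the deviations of the factors from 1
    are dominated by a geometric series, so holomorphy passes from the partial products to the
    limit.\<close>
  have "uniformly_convergent_on (cball x 1) (\<lambda>N z. \<Prod>n<N. 1 + (- z * q ^ n))"
  proof (rule uniformly_convergent_on_prod)
    show "uniformly_convergent_on (cball x 1) (\<lambda>N z. \<Sum>n<N. norm (- z * q ^ n))"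
    proof (rule Weierstrass_m_test')
      fix n z assume "z \<in> cball x 1"
      then have "norm z \<le> norm x + 1"
        by (smt (verit) dist_norm mem_cball norm_minus_commute norm_triangle_ineq2)
      then show "norm (norm (- z * q ^ n)) \<le> (norm x + 1) * norm q ^ n"
        by (simp add: norm_mult norm_power mult_right_mono)
    qed (use assms in \<open>auto intro!: summable_mult summable_geometric\<close>)
  qed (auto intro!: continuous_intros)
  then have "uniform_limit (cball x 1) (\<lambda>m z. qpoch z q m) (\<lambda>z. lim (\<lambda>m. qpoch z q m)) sequentially"
    by (simp add: uniformly_convergent_uniform_limit_iff qpoch_def)
  moreover have "lim (\<lambda>m. qpoch z q m) = qpoch_inf z q" for z
    using qpoch_tendsto[OF assms] by (rule limI)
  ultimately show "\<exists>d>0. cball x d \<subseteq> UNIV \<and>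
      uniform_limit (cball x d) (\<lambda>m z. qpoch z q m) (\<lambda>z. qpoch_inf z q) sequentially"
    by (intro exI[of _ 1]) simp
qed auto

lemma holomorphic_qpoch_inf [holomorphic_intros]:
  assumes "f holomorphic_on S" and "norm q < 1"
  shows "(\<lambda>z. qpoch_inf (f z) q) holomorphic_on S"
  using holomorphic_on_compose_gen[OF assms(1) holomorphic_qpoch_inf_aux[OF assms(2)]]
  by (simp add: o_def)

text \<open>Passing to \<open>q * z\<close> removes the factor \<open>1 - z\<close> from the first
  product and adds \<open>1 - 1 / z\<close> to the second; the quotient of the two is
  \<open>- 1 / z\<close>.\<close>

lemma theta_j_shift:
  assumes "norm q < 1" and "q \<noteq> 0" and "z \<noteq> 0"
  shows "theta_j (q * z) q = - theta_j z q / z"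
proof -
  have 1: "qpoch_inf z q = (1 - z) * qpoch_inf (q * z) q"
    using qpoch_inf_step[OF assms(1), of z] by (simp add: mult_ac)
  have 2: "qpoch_inf (q / (q * z)) q = (1 - 1 / z) * qpoch_inf (q / z) q"
    using qpoch_inf_step[OF assms(1), of "1 / z"] assms by simp
  have 3: "1 - 1 / z = (1 - z) * (- 1 / z)" using assms by (simp add: field_simps)
  show ?thesis
    unfolding theta_j_def 1 2 3 by simp
qed

section \<open>The meromorphic continuation of the rank generating function\<close>

text \<open>\<open>(qx; q)\<^sub>\<infinity> R(x; q)\<close>, which has no poles in \<open>|x| > |q|\<close>.\<close>

definition rank_num :: "complex \<Rightarrow> complex \<Rightarrow> complex" where
  "rank_num x q = qpoch_inf (q * x) q
     + 2 * (\<Sum>m. q ^ Suc m / x ^ m * (qpoch (- q * x) q m * qpoch_inf (q ^ (m + 2) * x) q))"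

text \<open>The bound is independent of \<open>m\<close>, so the series in \<open>rank_num\<close>
  has a geometric majorant of ratio \<open>norm (q / x)\<close>.\<close>

lemma norm_rank_coeff_le:
  assumes "norm q < 1"
  shows "norm (qpoch (- q * x) q m * qpoch_inf (q ^ (m + 2) * x) q) \<le> exp (2 * norm x / (1 - norm q))"
proof -
  have "norm (q * x) \<le> norm x"
    using assms by (simp add: norm_mult mult_left_le_one_le)
  then have "norm (qpoch (- q * x) q m) \<le> exp (norm x / (1 - norm q))"
    using norm_qpoch_le[OF assms, of "- q * x" m] assms
    by (smt (verit) divide_right_mono exp_le_cancel_iff mult_minus_left norm_minus_cancel)
  moreover have "norm (q ^ (m + 2) * x) \<le> norm x"
    using assms by (simp add: norm_mult norm_power mult_left_le_one_le power_le_one mult_le_one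
        del: power_Suc flip: power_Suc)
  then have "norm (qpoch_inf (q ^ (m + 2) * x) q) \<le> exp (norm x / (1 - norm q))"
    using norm_qpoch_inf_le[OF assms, of "q ^ (m + 2) * x"] assms
    by (smt (verit) divide_right_mono exp_le_cancel_iff)
  ultimately have "norm (qpoch (- q * x) q m * qpoch_inf (q ^ (m + 2) * x) q)
      \<le> exp (norm x / (1 - norm q)) * exp (norm x / (1 - norm q))"
    unfolding norm_mult by (intro mult_mono) auto
  then show ?thesis by (simp flip: exp_add)
qed

text \<open>The free \<open>y\<close> covers both \<open>y = q / x\<close>, needed for
  \<open>rank_num x q\<close>, and \<open>y = 1 / x\<close>, which arises from
  \<open>rank_num (q * x) q\<close>.\<close>

lemma summable_rank_coeff:
  assumes "norm q < 1" and "norm y < 1"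
  shows "summable (\<lambda>m. y ^ m * (qpoch (- q * x) q m * qpoch_inf (q ^ (m + 2) * x) q))"
proof (rule summable_comparison_test')
  show "summable (\<lambda>m. norm y ^ m * exp (2 * norm x / (1 - norm q)))"
    using assms by (intro summable_mult2 summable_geometric) simp
  show "norm (y ^ m * (qpoch (- q * x) q m * qpoch_inf (q ^ (m + 2) * x) q))
      \<le> norm y ^ m * exp (2 * norm x / (1 - norm q))" if "m \<ge> 0" for m
    using norm_rank_coeff_le[OF assms(1), of x m]
    by (subst norm_mult) (simp add: norm_power mult_left_mono)
qed

lemma summable_rank_num:
  assumes "norm q < 1" and "norm q < norm x"
  shows "summable (\<lambda>m. q ^ Suc m / x ^ m * (qpoch (- q * x) q m * qpoch_inf (q ^ (m + 2) * x) q))"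
proof -
  have "norm (q / x) < 1"
    using assms by (simp add: norm_divide divide_less_eq)
  from summable_mult[OF summable_rank_coeff[OF assms(1) this], of q x]
  show ?thesis by (simp add: power_divide mult.assoc)
qed

text \<open>Both values of \<open>rank_num\<close> reduce to series in the same coefficients
  \<open>v m\<close>, with weights \<open>(q / x) ^ m\<close> and \<open>(1 / x) ^ m\<close>. The
  coefficients obey a first-order recurrence, and summing it gives a linear relation between the two
  series. The condition \<open>norm x > 1\<close> makes the second one converge.\<close>

lemma rank_num_functional_equation:
  assumes q: "norm q < 1" "q \<noteq> 0" and x: "norm x > 1"
  shows "(1 - x) * (1 + q * x) * rank_num (q * x) q + q * x ^ 2 * (1 + x) * rank_num x q
       = (1 - q * x ^ 2) * qpoch_inf x q"
proof -
  define v where "v m = qpoch (- q * x) q m * qpoch_inf (q ^ (m + 2) * x) q" for m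
  have x0: "x \<noteq> 0" using x by auto
  have n: "norm (1 / x) < 1" "norm (q / x) < 1"
    using q x by (auto simp: norm_divide divide_less_eq)
  define S0 where "S0 = (\<Sum>m. (1 / x) ^ m * v m)"
  define S1 where "S1 = (\<Sum>m. (q / x) ^ m * v m)"
  have s0: "(\<lambda>m. (1 / x) ^ m * v m) sums S0" and s1: "(\<lambda>m. (q / x) ^ m * v m) sums S1"
    unfolding S0_def S1_def v_def by (intro summable_sums summable_rank_coeff q n)+
  have "(\<lambda>m. (1 / x) ^ Suc m * v (Suc m)) sums (S0 - v 0)"
    "(\<lambda>m. (q / x) ^ Suc m * v (Suc m)) sums (S1 - v 0)"
    using s0 s1 sums_Suc_iff[of "\<lambda>m. (1 / x) ^ m * v m" "S0 - v 0"]
      sums_Suc_iff[of "\<lambda>m. (q / x) ^ m * v m" "S1 - v 0"] by simp_all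
  from sums_mult[OF this(1), of x] sums_mult[OF this(2), of "x / q"]
  have s0': "(\<lambda>m. (1 / x) ^ m * v (Suc m)) sums (x * (S0 - v 0))"
    and s1': "(\<lambda>m. (q / x) ^ m * v (Suc m)) sums (x / q * (S1 - v 0))"
    using x0 q by (simp_all add: mult.assoc)
  \<comment> \<open>Written so that \<open>q ^ m\<close> stands alone: after multiplication by
    \<open>(1 / x) ^ m\<close> it changes the weight into \<open>(q / x) ^ m\<close>.\<close>
  have rec: "v (Suc m) - x * q ^ 2 * q ^ m * v (Suc m) = v m + x * q * q ^ m * v m" for m
  proof -
    have "qpoch_inf (q ^ (m + 2) * x) q = (1 - q ^ (m + 2) * x) * qpoch_inf (q ^ (Suc m + 2) * x) q"
      using qpoch_inf_step[OF q(1), of "q ^ (m + 2) * x"] by (simp add: mult_ac)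
    then show ?thesis
      by (simp add: v_def qpoch_Suc) (simp add: algebra_simps power2_eq_square)
  qed
  have "(\<lambda>m. (1 / x) ^ m * v (Suc m) - x * q ^ 2 * ((q / x) ^ m * v (Suc m)))
      sums (x * (S0 - v 0) - x * q ^ 2 * (x / q * (S1 - v 0)))"
    by (intro sums_diff sums_mult s0' s1')
  moreover have "(\<lambda>m. (1 / x) ^ m * v m + x * q * ((q / x) ^ m * v m)) sums (S0 + x * q * S1)"
    by (intro sums_add sums_mult s0 s1)
  moreover have "(1 / x) ^ m * v (Suc m) - x * q ^ 2 * ((q / x) ^ m * v (Suc m))
      = (1 / x) ^ m * v m + x * q * ((q / x) ^ m * v m)" for m
    using arg_cong[OF rec[of m], of "\<lambda>t. (1 / x) ^ m * t"] by (simp add: power_divide algebra_simps)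
  ultimately have "x * (S0 - v 0) - x * q ^ 2 * (x / q * (S1 - v 0)) = S0 + x * q * S1"
    using sums_unique2 by simp
  then have key: "x * (S0 - v 0) - x ^ 2 * q * (S1 - v 0) = S0 + x * q * S1"
    using q(2) by (simp add: power2_eq_square mult_ac)
  have v0: "qpoch_inf (q * x) q = (1 - q * x) * v 0" "qpoch_inf x q = (1 - x) * ((1 - q * x) * v 0)"
    using qpoch_inf_step[OF q(1), of x] qpoch_inf_step[OF q(1), of "q * x"]
    by (simp_all add: v_def power2_eq_square mult_ac)
  have r1: "rank_num x q = (1 - q * x) * v 0 + 2 * (q * S1)"
  proof -
    have "(\<lambda>m. q * ((q / x) ^ m * v m)) sums (q * S1)"
      by (intro sums_mult s1)
    then have "(\<Sum>m. q ^ Suc m / x ^ m * v m) = q * S1"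
      by (simp add: sums_iff power_divide mult.assoc)
    then show ?thesis unfolding rank_num_def v_def[symmetric] v0 by simp
  qed
  \<comment> \<open>The factor \<open>1 + q * x\<close> completes
    \<open>qpoch (- q * (q * x)) q m\<close> to \<open>qpoch (- q * x) q (Suc m)\<close>, so the
    series at \<open>q * x\<close> becomes the shifted series of \<open>s0'\<close>.\<close>
  have r2: "(1 + q * x) * rank_num (q * x) q = (1 + q * x) * v 0 + 2 * (q * (x * (S0 - v 0)))"
  proof -
    have s: "summable (\<lambda>m. q ^ Suc m / (q * x) ^ m *
        (qpoch (- q * (q * x)) q m * qpoch_inf (q ^ (m + 2) * (q * x)) q))"
      by (rule summable_rank_num) (use q x in \<open>auto simp: norm_mult\<close>)
    have "(1 + q * x) * (q ^ Suc m / (q * x) ^ m *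
        (qpoch (- q * (q * x)) q m * qpoch_inf (q ^ (m + 2) * (q * x)) q))
        = q * ((1 / x) ^ m * v (Suc m))" for m
      using q(2) by (simp add: v_def qpoch_Suc_shift power_mult_distrib power_divide mult_ac)
    then have "(\<lambda>m. (1 + q * x) * (q ^ Suc m / (q * x) ^ m *
        (qpoch (- q * (q * x)) q m * qpoch_inf (q ^ (m + 2) * (q * x)) q)))
        sums (q * (x * (S0 - v 0)))"
      using sums_mult[OF s0', of q] by simp
    then have "(1 + q * x) * (\<Sum>m. q ^ Suc m / (q * x) ^ m *
        (qpoch (- q * (q * x)) q m * qpoch_inf (q ^ (m + 2) * (q * x)) q))
        = q * (x * (S0 - v 0))"
      using suminf_mult[OF s, of "1 + q * x"] by (simp add: sums_iff)
    moreover have "qpoch_inf (q * (q * x)) q = v 0"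
      by (simp add: v_def power2_eq_square mult_ac)
    ultimately show ?thesis
      unfolding rank_num_def by (simp only: distrib_left mult.left_commute[of "1 + q * x" 2])
  qed
  have "(1 - x) * ((1 + q * x) * rank_num (q * x) q) + q * x ^ 2 * (1 + x) * rank_num x q
       = (1 - q * x ^ 2) * qpoch_inf x q"
    unfolding r1 r2 v0 using key by algebra
  then show ?thesis by (simp add: mult.assoc)
qed

lemma holomorphic_rank_num:
  assumes q: "norm q < 1"
  shows "(\<lambda>x. rank_num x q) holomorphic_on {x. norm q < norm x}"
proof -
  let ?t = "\<lambda>m x. q ^ Suc m / x ^ m * (qpoch (- q * x) q m * qpoch_inf (q ^ (m + 2) * x) q)"
  have "(\<lambda>x. \<Sum>m. ?t m x) holomorphic_on {x. norm q < norm x}"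
  proof (rule holomorphic_uniform_sequence)
    show "open {x. norm q < norm x}"
      by (intro open_Collect_less continuous_intros)
    have "x \<noteq> 0" if "norm q < norm x" for x :: complex
      using that by auto
    then show "(\<lambda>x. \<Sum>m<n. ?t m x) holomorphic_on {x. norm q < norm x}" for n
      by (intro holomorphic_intros q) auto
    fix x :: complex assume "x \<in> {x. norm q < norm x}"
    \<comment> \<open>Half the distance from \<open>norm x\<close> to \<open>norm q\<close>: on the
      disc of this radius the ratio \<open>norm q / (norm x - d)\<close> stays below 1 and gives one
      majorant for all points.\<close>
    define d where "d = (norm x - norm q) / 2"
    have d: "d > 0" "norm q < norm x - d" using \<open>x \<in> _\<close> by (auto simp: d_def field_simps)
    have z: "norm x - d \<le> norm z" "norm z \<le> norm x + d" if "z \<in> cball x d" for z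
      using that norm_triangle_ineq2[of x z] norm_triangle_ineq2[of z x]
      by (auto simp: dist_norm norm_minus_commute)
    define C where "C = exp (2 * (norm x + d) / (1 - norm q))"
    have "uniform_limit (cball x d) (\<lambda>n x. \<Sum>m<n. ?t m x) (\<lambda>x. \<Sum>m. ?t m x) sequentially"
    proof (rule Weierstrass_m_test)
      show "summable (\<lambda>m. norm q * (norm q / (norm x - d)) ^ m * C)"
        using d order_le_less_trans[OF norm_ge_zero d(2)]
        by (intro summable_mult summable_mult2 summable_geometric) (simp add: divide_less_eq abs_of_pos)
      fix m z assume "z \<in> cball x d"
      from z[OF this] have "norm x - d \<le> norm z" "norm z \<le> norm x + d" by auto
      have "norm (q ^ Suc m / z ^ m) = norm q * (norm q ^ m / norm z ^ m)"
        by (simp add: norm_mult norm_divide norm_power)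
      also have "\<dots> \<le> norm q * (norm q ^ m / (norm x - d) ^ m)"
        using d \<open>norm x - d \<le> norm z\<close> order_le_less_trans[OF norm_ge_zero d(2)]
        by (intro mult_left_mono divide_left_mono power_mono mult_pos_pos zero_less_power) auto
      finally have "norm (q ^ Suc m / z ^ m) \<le> norm q * (norm q / (norm x - d)) ^ m"
        by (simp add: power_divide)
      moreover have "exp (2 * norm z / (1 - norm q)) \<le> C"
        using \<open>norm z \<le> norm x + d\<close> q by (simp add: C_def divide_right_mono)
      then have "norm (qpoch (- q * z) q m * qpoch_inf (q ^ (m + 2) * z) q) \<le> C"
        using norm_rank_coeff_le[OF q, of z m] by linarith
      moreover have "0 \<le> norm q * (norm q / (norm x - d)) ^ m"
        using d norm_ge_zero[of q] by (intro mult_nonneg_nonneg zero_le_power divide_nonneg_nonneg) linarith+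
      ultimately show "norm (?t m z) \<le> norm q * (norm q / (norm x - d)) ^ m * C"
        unfolding norm_mult[of "q ^ Suc m / z ^ m"] by (intro mult_mono) auto
    qed
    moreover have "cball x d \<subseteq> {x. norm q < norm x}"
      using z d by fastforce
    ultimately show "\<exists>d>0. cball x d \<subseteq> {x. norm q < norm x} \<and>
        uniform_limit (cball x d) (\<lambda>n x. \<Sum>m<n. ?t m x) (\<lambda>x. \<Sum>m. ?t m x) sequentially"
      using d by blast
  qed
  then show ?thesis
    unfolding rank_num_def by (intro holomorphic_intros q)
qed

section \<open>Counting overpartitions by rank\<close>

definition all_overpartitions :: "overpartition set" where
  "all_overpartitions = {(P, S). (\<forall>k \<in># P. k > 0) \<and> S \<subseteq> set_mset P}"

definition bounded_overpartitions :: "nat \<Rightarrow> overpartition set" where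
  "bounded_overpartitions m = {(P, S). set_mset P \<subseteq> {1..m} \<and> S \<subseteq> set_mset P}"

definition part_weight :: "complex \<Rightarrow> complex \<Rightarrow> overpartition \<Rightarrow> complex" where
  "part_weight x q = (\<lambda>(P, S). x ^ size P * q ^ sum_mset P)"

text \<open>The contribution of a single part size: \<open>j\<close> is its multiplicity and
  \<open>b\<close> tells whether its first occurrence is overlined, which requires
  \<open>j > 0\<close>. Hence \<open>1 / (1 - c)\<close> without and \<open>c / (1 - c)\<close> with
  the mark.\<close>

lemma has_sum_marked_powers:
  fixes c :: complex
  assumes "norm c < 1"
  shows "((\<lambda>(j, b). c ^ j) has_sum ((1 + c) / (1 - c))) {(j, b). b \<longrightarrow> 0 < (j :: nat)}"
proof -
  have c: "((\<lambda>j. c ^ j) has_sum (1 / (1 - c))) UNIV"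
    using assms by (intro norm_summable_imp_has_sum geometric_sums)
      (auto simp: norm_power summable_geometric)
  have 1: "((\<lambda>(j, b). c ^ j) has_sum (1 / (1 - c))) (range (\<lambda>j :: nat. (j, False)))"
    using c by (subst has_sum_reindex) (auto simp: inj_on_def o_def)
  have 2: "((\<lambda>(j, b). c ^ j) has_sum (c * (1 / (1 - c)))) (range (\<lambda>j :: nat. (Suc j, True)))"
    using has_sum_cmult_right[OF c, of c] by (subst has_sum_reindex) (auto simp: inj_on_def o_def)
  have "{(j, b). b \<longrightarrow> 0 < (j :: nat)} = range (\<lambda>j. (j, False)) \<union> range (\<lambda>j. (Suc j, True))"
    by (auto simp: image_iff gr0_conv_Suc)
  moreover have "(1 + c) / (1 - c) = 1 / (1 - c) + c * (1 / (1 - c))"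
    by (simp add: add_divide_distrib)
  ultimately show ?thesis
    using has_sum_Un_disjoint[OF 1 2] by auto
qed

text \<open>Splits off the copies of \<open>Suc m\<close> together with the mark on that
  size.\<close>

lemma bij_betw_bounded_overpartitions_Suc:
  "bij_betw (\<lambda>((P, S), (j, b)). (P + replicate_mset j (Suc m), if b then insert (Suc m) S else S))
     (bounded_overpartitions m \<times> {(j, b). b \<longrightarrow> 0 < j}) (bounded_overpartitions (Suc m))"
proof (rule bij_betw_byWitness)
  let ?g = "\<lambda>(P, S). ((filter_mset (\<lambda>k. k \<noteq> Suc m) P, S - {Suc m}), (count P (Suc m), Suc m \<in> S))"
  have f1: "filter_mset (\<lambda>k. k \<noteq> Suc m) P = P" "count P (Suc m) = 0" if "set_mset P \<subseteq> {1..m}" for P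
    using that by (auto simp: filter_mset_eq_conv count_eq_zero_iff)
  have f2: "filter_mset (\<lambda>k. k \<noteq> Suc m) (replicate_mset j (Suc m)) = {#}" for j
    by (induction j) auto
  show "\<forall>a\<in>bounded_overpartitions m \<times> {(j, b). b \<longrightarrow> 0 < j}.
      ?g ((\<lambda>((P, S), (j, b)). (P + replicate_mset j (Suc m), if b then insert (Suc m) S else S)) a) = a"
    unfolding bounded_overpartitions_def by (auto simp: f1 f2)
  have f3: "filter_mset (\<lambda>k. k \<noteq> Suc m) P + replicate_mset (count P (Suc m)) (Suc m) = P" for P
    by (rule multiset_eqI) simp
  have f4: "(if Suc m \<in> S then insert (Suc m) (S - {Suc m}) else S - {Suc m}) = S" for S
    by auto
  show "\<forall>a\<in>bounded_overpartitions (Suc m).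
      (\<lambda>((P, S), (j, b)). (P + replicate_mset j (Suc m), if b then insert (Suc m) S else S)) (?g a) = a"
    by (auto simp: f3 f4 simp del: insert_Diff_single)
  show "(\<lambda>((P, S), (j, b)). (P + replicate_mset j (Suc m), if b then insert (Suc m) S else S)) `
      (bounded_overpartitions m \<times> {(j, b). b \<longrightarrow> 0 < j}) \<subseteq> bounded_overpartitions (Suc m)"
    unfolding bounded_overpartitions_def set_mset_union set_mset_replicate_mset_subset
      atLeastAtMostSuc_conv[OF Suc_le_mono[THEN iffD2, OF le0]]
    by (auto split: if_splits)
  show "?g ` bounded_overpartitions (Suc m) \<subseteq> bounded_overpartitions m \<times> {(j, b). b \<longrightarrow> 0 < j}"
    unfolding bounded_overpartitions_def by (auto simp: atLeastAtMostSuc_conv)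
qed

text \<open>Induction on the largest admissible part: the size \<open>Suc m\<close> contributes the
  independent factor \<open>(1 + c) / (1 - c)\<close> with \<open>c = x * q ^ Suc m\<close>.\<close>

lemma has_sum_bounded_overpartitions:
  assumes q: "norm q < 1" and x: "norm x \<le> 1"
  shows "(part_weight x q has_sum (qpoch (- q * x) q m / qpoch (q * x) q m)) (bounded_overpartitions m)"
proof (induction m)
  case 0
  have "bounded_overpartitions 0 = {({#}, {})}"
    by (auto simp: bounded_overpartitions_def)
  then show ?case
    using has_sum_finite[of "{({#}, {})}" "part_weight x q"] by (simp add: part_weight_def)
next
  case (Suc m)
  let ?B = "{(j, b). b \<longrightarrow> 0 < (j :: nat)}"
  define c where "c = x * q ^ Suc m"
  have "norm x * norm q ^ Suc m \<le> 1 * norm q ^ 1"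
    using q x by (intro mult_mono power_decreasing) auto
  then have c: "norm c < 1" using q by (simp add: c_def norm_mult norm_power)
  let ?h = "\<lambda>((P, S), (j, b)). (P + replicate_mset j (Suc m), if b then insert (Suc m) S else S)"
  define f where "f z = part_weight x q (fst z) * (\<lambda>(j, b :: bool). c ^ j) (snd z)"
    for z :: "overpartition \<times> nat \<times> bool"
  have "(\<lambda>z. norm (f z)) summable_on (bounded_overpartitions m \<times> ?B)"
  proof (rule Infinite_Sum.abs_summable_on_Sigma_iff[THEN iffD2], intro conjI ballI)
    have B: "(\<lambda>y. norm ((\<lambda>(j, b :: bool). c ^ j) y)) summable_on ?B"
      using has_sum_imp_summable[OF has_sum_marked_powers[OF c]]
      by (simp only: summable_on_iff_abs_summable_on_complex)
    then show "(\<lambda>y. norm (f (a, y))) summable_on ?B" for a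
      by (simp add: f_def norm_mult summable_on_cmult_right)
    have "(\<lambda>a. norm (part_weight x q a)) summable_on bounded_overpartitions m"
      using has_sum_imp_summable[OF Suc] by (simp only: summable_on_iff_abs_summable_on_complex)
    from summable_on_cmult_left[OF this, of "infsum (\<lambda>y. norm ((\<lambda>(j, b :: bool). c ^ j) y)) ?B"]
    show "(\<lambda>a. norm (\<Sum>\<^sub>\<infinity>y\<in>?B. norm (f (a, y)))) summable_on bounded_overpartitions m"
      by (simp add: f_def norm_mult infsum_cmult_right' abs_mult infsum_nonneg)
  qed
  then have s: "(\<lambda>z. part_weight x q (fst z) * (\<lambda>(j, b). c ^ j) (snd z)) summable_on
      (bounded_overpartitions m \<times> ?B)"
    by (simp add: summable_on_iff_abs_summable_on_complex f_def)
  have "((\<lambda>z. part_weight x q (fst z) * (\<lambda>(j, b). c ^ j) (snd z)) has_sum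
      (qpoch (- q * x) q m / qpoch (q * x) q m * ((1 + c) / (1 - c)))) (bounded_overpartitions m \<times> ?B)"
  proof (rule has_sum_SigmaI[OF _ _ s])
    show "((\<lambda>y. part_weight x q (fst (a, y)) * (\<lambda>(j, b). c ^ j) (snd (a, y))) has_sum
        (part_weight x q a * ((1 + c) / (1 - c)))) ?B" for a
      using has_sum_cmult_right[OF has_sum_marked_powers[OF c]] by simp
  qed (rule has_sum_cmult_left[OF Suc])
  also have "(\<lambda>z. part_weight x q (fst z) * (\<lambda>(j, b). c ^ j) (snd z)) = (\<lambda>z. part_weight x q (?h z))"
  proof
    fix z :: "overpartition \<times> nat \<times> bool"
    obtain P S j b where "z = ((P, S), (j, b))" by (cases z) auto
    then show "part_weight x q (fst z) * (\<lambda>(j, b). c ^ j) (snd z) = part_weight x q (?h z)"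
      by (simp add: part_weight_def c_def power_add power_mult_distrib mult_ac flip: power_mult)
  qed
  finally have "(part_weight x q has_sum
      (qpoch (- q * x) q m / qpoch (q * x) q m * ((1 + c) / (1 - c)))) (bounded_overpartitions (Suc m))"
    by (subst (asm) has_sum_reindex_bij_betw[OF bij_betw_bounded_overpartitions_Suc])
  then show ?case by (simp add: qpoch_Suc c_def mult_ac)
qed

text \<open>Finitely many overpartitions have bounded parts, so their sum is at most the product for
  some \<open>m\<close>, taken at \<open>x = 1\<close> with the real nome \<open>norm q\<close>.
  These products converge and are therefore bounded.\<close>

lemma summable_on_all_overpartitions:
  assumes q: "norm q < 1"
  shows "(\<lambda>\<pi>. norm q ^ sum_mset (fst \<pi>)) summable_on all_overpartitions"
proof (rule nonneg_bdd_above_summable_on)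
  define r where "r = complex_of_real (norm q)"
  have r: "norm r < 1" using q by (simp add: r_def)
  let ?W = "\<lambda>m. qpoch (- r * 1) r m / qpoch (r * 1) r m"
  have "?W \<longlonglongrightarrow> qpoch_inf (- r * 1) r / qpoch_inf (r * 1) r"
    by (intro tendsto_divide qpoch_tendsto r qpoch_inf_nonzero_norm) (use r in simp)
  then have "Bseq ?W" by (intro convergent_imp_Bseq convergentI)
  then obtain K where K: "\<And>m. norm (?W m) \<le> K" using BseqE by blast
  show "bdd_above (sum (\<lambda>\<pi>. norm q ^ sum_mset (fst \<pi>)) ` {F. F \<subseteq> all_overpartitions \<and> finite F})"
  proof (rule bdd_aboveI2)
    fix F assume "F \<in> {F. F \<subseteq> all_overpartitions \<and> finite F}"
    then have F: "F \<subseteq> all_overpartitions" "finite F" by auto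
    define m where "m = Max (insert 0 (\<Union>\<pi>\<in>F. set_mset (fst \<pi>)))"
    have le: "k \<le> m" if "\<pi> \<in> F" "k \<in># fst \<pi>" for \<pi> k
      unfolding m_def by (rule Max_ge) (use F that in auto)
    then have sub: "F \<subseteq> bounded_overpartitions m"
    proof (intro subsetI)
      fix \<pi> assume "\<pi> \<in> F"
      moreover obtain P S where "\<pi> = (P, S)" by (cases \<pi>)
      ultimately show "\<pi> \<in> bounded_overpartitions m"
        using F(1) le[of \<pi>] by (auto simp: all_overpartitions_def bounded_overpartitions_def Suc_le_eq)
    qed
    have "((\<lambda>\<pi>. Re (part_weight 1 r \<pi>)) has_sum Re (?W m)) (bounded_overpartitions m)"
      by (intro has_sum_Re has_sum_bounded_overpartitions r) simp
    also have "(\<lambda>\<pi>. Re (part_weight 1 r \<pi>)) = (\<lambda>\<pi>. norm q ^ sum_mset (fst \<pi>))"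
      by (auto simp: part_weight_def r_def simp flip: of_real_power)
    finally have "sum (\<lambda>\<pi>. norm q ^ sum_mset (fst \<pi>)) F \<le> Re (?W m)"
      using sub F(2) by (intro finite_sum_le_has_sum) auto
    also have "\<dots> \<le> K" using K[of m] complex_Re_le_cmod order_trans by blast
    finally show "sum (\<lambda>\<pi>. norm q ^ sum_mset (fst \<pi>)) F \<le> K" .
  qed
qed simp

text \<open>With minus the rank as exponent, every part contributes one factor \<open>x\<close>, and
  the largest part only a negative power that is fixed once that part is fixed.\<close>

definition rank_weight :: "complex \<Rightarrow> complex \<Rightarrow> overpartition \<Rightarrow> complex" where
  "rank_weight x q \<pi> = x powi (- overpartition_rank \<pi>) * q ^ sum_mset (fst \<pi>)"

lemma summable_on_rank_weight:
  assumes q: "norm q < 1" and x: "norm x = 1"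
  shows "rank_weight x q summable_on all_overpartitions"
proof -
  have "norm (rank_weight x q \<pi>) = norm q ^ sum_mset (fst \<pi>)" for \<pi>
    using x by (simp add: rank_weight_def norm_mult norm_power norm_power_int)
  then show ?thesis
    using summable_on_all_overpartitions[OF q]
    by (simp add: summable_on_iff_abs_summable_on_complex)
qed

text \<open>The set difference consists of the overpartitions with largest part exactly
  \<open>Suc m\<close>. There the weight is \<open>part_weight\<close> divided by
  \<open>x ^ Suc m\<close>, so the sum is a difference of two consecutive products.\<close>

lemma has_sum_largest_part:
  assumes q: "norm q < 1" and x: "norm x = 1"
  shows "(rank_weight x q has_sum
      2 * (q ^ Suc m / x ^ m * (qpoch (- q * x) q m / qpoch (q * x) q (Suc m))))
      (bounded_overpartitions (Suc m) - bounded_overpartitions m)"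
proof -
  let ?W = "\<lambda>m. qpoch (- q * x) q m / qpoch (q * x) q m"
  let ?c = "q * x * q ^ m"
  have x0: "x \<noteq> 0" using x by auto
  have "norm ?c \<le> norm q * 1 * 1"
    unfolding norm_mult norm_power using x q by (intro mult_mono power_le_one) auto
  then have c: "1 - ?c \<noteq> 0" using q by auto
  have "(part_weight x q has_sum (?W (Suc m) - ?W m))
      (bounded_overpartitions (Suc m) - bounded_overpartitions m)"
    using x by (intro has_sum_Diff has_sum_bounded_overpartitions q)
      (auto simp: bounded_overpartitions_def)
  then have "((\<lambda>\<pi>. 1 / x ^ Suc m * part_weight x q \<pi>) has_sum (1 / x ^ Suc m * (?W (Suc m) - ?W m)))
      (bounded_overpartitions (Suc m) - bounded_overpartitions m)"
    by (rule has_sum_cmult_right)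
  also have "?this \<longleftrightarrow> (rank_weight x q has_sum (1 / x ^ Suc m * (?W (Suc m) - ?W m)))
      (bounded_overpartitions (Suc m) - bounded_overpartitions m)"
  proof (intro has_sum_cong)
    fix \<pi> assume "\<pi> \<in> bounded_overpartitions (Suc m) - bounded_overpartitions m"
    moreover obtain P S where \<pi>: "\<pi> = (P, S)" by (cases \<pi>)
    ultimately have P: "set_mset P \<subseteq> {1..Suc m}" "\<not> set_mset P \<subseteq> {1..m}"
      by (auto simp: bounded_overpartitions_def)
    then have "Suc m \<in># P" by (auto simp: subset_iff le_Suc_eq)
    then have "Max (set_mset P) = Suc m" "P \<noteq> {#}"
      using P by (auto intro!: Max_eqI)
    then have "- overpartition_rank \<pi> = int (size P) - int (Suc m)"
      by (simp add: overpartition_rank_def \<pi>)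
    then have "x powi (- overpartition_rank \<pi>) = x ^ size P / x ^ Suc m"
      using x0 by (simp add: power_int_diff del: of_nat_Suc)
    then show "1 / x ^ Suc m * part_weight x q \<pi> = rank_weight x q \<pi>"
      by (simp add: rank_weight_def part_weight_def \<pi>)
  qed
  also have "1 / x ^ Suc m * (?W (Suc m) - ?W m)
      = 2 * (q ^ Suc m / x ^ m * (qpoch (- q * x) q m / qpoch (q * x) q (Suc m)))"
  proof -
    \<comment> \<open>From \<open>(1 + c) / (1 - c) - 1 = 2 * c / (1 - c)\<close>. In the degenerate
      case of a zero denominator both sides are 0 by the convention
      \<open>a / 0 = 0\<close>.\<close>
    have "?W (Suc m) - ?W m = 2 * ?c * (qpoch (- q * x) q m / qpoch (q * x) q (Suc m))"
    proof (cases "qpoch (q * x) q m = 0")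
      case False
      with c show ?thesis by (simp add: qpoch_Suc divide_simps) (simp add: algebra_simps)
    qed (simp add: qpoch_Suc)
    then show ?thesis using x0 by (simp add: field_simps)
  qed
  finally show ?thesis .
qed

text \<open>The empty overpartition stands apart: it has no largest part, its rank is 0 by
  convention, and it supplies the leading 1 of the generating function.\<close>

lemma all_overpartitions_eq:
  "all_overpartitions = insert ({#}, {})
     (\<Union>m. bounded_overpartitions (Suc m) - bounded_overpartitions m)"
proof (intro equalityI subsetI)
  fix \<pi> assume \<pi>: "\<pi> \<in> all_overpartitions"
  obtain P S where PS: "\<pi> = (P, S)" by (cases \<pi>)
  show "\<pi> \<in> insert ({#}, {}) (\<Union>m. bounded_overpartitions (Suc m) - bounded_overpartitions m)"
  proof (cases "P = {#}")
    case True
    with \<pi> PS show ?thesis by (auto simp: all_overpartitions_def)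
  next
    case False
    then have M: "Max (set_mset P) \<in># P" "\<forall>k\<in>#P. k \<le> Max (set_mset P)" by auto
    have pos: "\<forall>k\<in>#P. k > 0" and S: "S \<subseteq> set_mset P"
      using \<pi> PS by (auto simp: all_overpartitions_def)
    with M obtain m where m: "Max (set_mset P) = Suc m"
      by (metis gr0_conv_Suc)
    have "set_mset P \<subseteq> {1..Suc m}" "\<not> set_mset P \<subseteq> {1..m}"
      using M pos unfolding m by (auto simp: Suc_le_eq)
    then have "\<pi> \<in> bounded_overpartitions (Suc m) - bounded_overpartitions m"
      using S PS by (simp add: bounded_overpartitions_def)
    then show ?thesis by blast
  qed
next
  fix \<pi> assume "\<pi> \<in> insert ({#}, {}) (\<Union>m. bounded_overpartitions (Suc m) - bounded_overpartitions m)"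
  moreover have "bounded_overpartitions m \<subseteq> all_overpartitions" for m
    by (auto simp: all_overpartitions_def bounded_overpartitions_def)
  moreover have "({#}, {}) \<in> all_overpartitions"
    by (simp add: all_overpartitions_def)
  ultimately show "\<pi> \<in> all_overpartitions" by blast
qed

text \<open>Absolute summability allows grouping by largest part. Multiplication by
  \<open>qpoch_inf (q * x) q\<close> then cancels the denominator of each term and produces the
  series of \<open>rank_num\<close>.\<close>

lemma has_sum_rank_weight:
  assumes q: "norm q < 1" and x: "norm x = 1"
  shows "(rank_weight x q has_sum (rank_num x q / qpoch_inf (q * x) q)) all_overpartitions"
proof -
  let ?L = "\<lambda>m. bounded_overpartitions (Suc m) - bounded_overpartitions m"
  let ?t = "\<lambda>m. 2 * (q ^ Suc m / x ^ m * (qpoch (- q * x) q m / qpoch (q * x) q (Suc m)))"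
  have "norm (q * x) < 1" using q x by (simp add: norm_mult)
  with q have nz: "qpoch_inf (q * x) q \<noteq> 0" by (rule qpoch_inf_nonzero_norm)
  have bij: "bij_betw snd (Sigma UNIV ?L) (\<Union>m. ?L m)"
  proof (rule bij_betwI')
    have mono: "bounded_overpartitions m \<subseteq> bounded_overpartitions n" if "m \<le> n" for m n
      using that atLeastatMost_subset_iff[of 1 m 1 n] unfolding bounded_overpartitions_def by blast
    have uniq: "m = n" if "\<pi> \<in> ?L m" "\<pi> \<in> ?L n" for m n \<pi>
    proof (rule ccontr)
      assume "m \<noteq> n"
      then consider "Suc m \<le> n" | "Suc n \<le> m" by linarith
      then show False using mono that by cases blast+
    qed
    show "(snd a = snd b) = (a = b)" if "a \<in> Sigma UNIV ?L" "b \<in> Sigma UNIV ?L" for a b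
      using that uniq by (cases a, cases b) auto
  qed auto
  have "rank_weight x q summable_on (\<Union>m. ?L m)"
    using summable_on_rank_weight[OF q x]
    by (rule summable_on_subset) (auto simp: all_overpartitions_eq)
  then obtain S where S: "(rank_weight x q has_sum S) (\<Union>m. ?L m)"
    by (auto simp: summable_on_def)
  then have "((\<lambda>z. rank_weight x q (snd z)) has_sum S) (Sigma UNIV ?L)"
    by (subst has_sum_reindex_bij_betw[OF bij])
  then have "(?t has_sum S) UNIV"
    by (rule has_sum_SigmaD) (use has_sum_largest_part[OF q x] in simp)
  then have "?t sums S" by (rule has_sum_imp_sums)
  from sums_mult[OF this, of "qpoch_inf (q * x) q"]
  have "(\<lambda>m. 2 * (q ^ Suc m / x ^ m * (qpoch (- q * x) q m * qpoch_inf (q ^ (m + 2) * x) q)))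
      sums (qpoch_inf (q * x) q * S)"
  proof (rule sums_cong[THEN iffD1, rotated])
    fix m
    have "qpoch_inf (q * x) q = qpoch (q * x) q (Suc m) * qpoch_inf (q ^ (m + 2) * x) q"
      using qpoch_inf_split[OF q, of "q * x" "Suc m"] by (simp add: mult_ac)
    with nz show "qpoch_inf (q * x) q * ?t m
        = 2 * (q ^ Suc m / x ^ m * (qpoch (- q * x) q m * qpoch_inf (q ^ (m + 2) * x) q))"
      by (simp add: field_simps)
  qed
  moreover have "(\<lambda>m. 2 * (q ^ Suc m / x ^ m * (qpoch (- q * x) q m * qpoch_inf (q ^ (m + 2) * x) q)))
      sums (rank_num x q - qpoch_inf (q * x) q)"
    unfolding rank_num_def add_diff_cancel_left'
    by (intro sums_mult summable_sums summable_rank_num) (use q x in auto)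
  ultimately have "rank_num x q / qpoch_inf (q * x) q = 1 + S"
    using nz sums_unique2[of _ "qpoch_inf (q * x) q * S"] by (force simp: divide_simps algebra_simps)
  moreover have "({#}, {}) \<notin> (\<Union>m. ?L m)"
    by (auto simp: bounded_overpartitions_def)
  with S have "(rank_weight x q has_sum (rank_weight x q ({#}, {}) + S)) all_overpartitions"
    unfolding all_overpartitions_eq by (intro has_sum_insert)
  ultimately show ?thesis
    by (simp add: rank_weight_def overpartition_rank_def)
qed

text \<open>The same absolutely convergent sum, regrouped by the number that is partitioned.\<close>

lemma rank_generating_function:
  assumes q: "norm q < 1" and x: "norm x = 1"
  shows "((\<lambda>n. (\<Sum>\<pi>\<in>overpartitions n. x powi (- overpartition_rank \<pi>)) * q ^ n) has_sum
    (rank_num x q / qpoch_inf (q * x) q)) UNIV"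
proof -
  have bij: "bij_betw snd (Sigma UNIV overpartitions) all_overpartitions"
    by (rule bij_betwI') (auto simp: overpartitions_def all_overpartitions_def)
  have "((\<lambda>z. rank_weight x q (snd z)) has_sum (rank_num x q / qpoch_inf (q * x) q))
      (Sigma UNIV overpartitions)"
    using has_sum_rank_weight[OF q x] by (subst has_sum_reindex_bij_betw[OF bij])
  then show ?thesis
  proof (rule has_sum_SigmaD)
    fix n :: nat
    show "((\<lambda>\<pi>. rank_weight x q (snd (n, \<pi>))) has_sum
        (\<Sum>\<pi>\<in>overpartitions n. x powi (- overpartition_rank \<pi>)) * q ^ n) (overpartitions n)"
      by (rule has_sum_finiteI[OF finite_overpartitions])
        (auto simp: rank_weight_def sum_distrib_right overpartitions_def intro!: sum.cong)
  qed
qed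

section \<open>An elliptic function built from the exponents 1 modulo 3\<close>

text \<open>The maximum of \<open>norm (f x)\<close> over a compact fundamental annulus is, by
  periodicity, a maximum over the whole open annulus, so the maximum modulus principle applies. By
  \<open>ab\<close> the ratio \<open>b / a\<close> exceeds \<open>1 / norm Q\<close> but not its
  square, so one step by \<open>Q\<close> takes any point to the fundamental annulus.\<close>

lemma holomorphic_multiplicatively_periodic_constant:
  assumes hol: "f holomorphic_on {x. a < norm x \<and> norm x < b}"
    and a: "a > 0" and Q: "Q \<noteq> 0" "norm Q < 1"
    and ab: "a < norm Q * b" "norm Q ^ 2 * b \<le> a"
    and per: "\<And>x. a < norm (Q * x) \<Longrightarrow> norm x < b \<Longrightarrow> f (Q * x) = f x"
  shows "f constant_on {x. a < norm x \<and> norm x < b}"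
proof -
  let ?A = "{x :: complex. a < norm x \<and> norm x < b}"
  have nQ: "norm Q > 0" using Q by simp
  have "a < a / norm Q" using a Q nQ by (simp add: field_simps)
  \<comment> \<open>\<open>r < norm Q * b\<close> puts the fundamental annulus inside the domain;
    \<open>r < a / norm Q\<close> ensures that points of modulus below \<open>r\<close> reach it
    after one division by \<open>Q\<close>.\<close>
  with ab obtain r where r: "a < r" "r < norm Q * b" "r < a / norm Q"
    using dense[of a "min (norm Q * b) (a / norm Q)"] by auto
  define K where "K = {x :: complex. r \<le> norm x \<and> norm x \<le> r / norm Q}"
  have rQ: "r / norm Q < b" using r nQ by (simp add: field_simps)
  have "K = cball 0 (r / norm Q) - ball 0 r" by (auto simp: K_def)
  then have "compact K" using compact_diff[OF compact_cball open_ball] by simp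
  have "norm (complex_of_real r) = r" using a r by simp
  moreover have "r * norm Q \<le> r" using Q a r by (simp add: mult_left_le)
  ultimately have "complex_of_real r \<in> K" using nQ by (simp add: K_def field_simps)
  then have "K \<noteq> {}" by blast
  have KA: "K \<subseteq> ?A" using r rQ by (auto simp: K_def)
  have "continuous_on K (\<lambda>x. norm (f x))"
    using holomorphic_on_imp_continuous_on[OF hol] KA
    by (intro continuous_on_norm) (rule continuous_on_subset)
  then obtain z where z: "z \<in> K" "\<And>x. x \<in> K \<Longrightarrow> norm (f x) \<le> norm (f z)"
    using continuous_attains_sup[OF \<open>compact K\<close> \<open>K \<noteq> {}\<close>] by blast
  have op: "open ?A"
    by (intro open_Collect_conj open_Collect_less continuous_intros)
  show ?thesis
  proof (rule maximum_modulus_principle[OF hol op _ op order_refl])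
    show "connected ?A"
      using connected_annulus(1)[of a "0::complex" b] by simp
    show "z \<in> ?A" using z KA by blast
    fix x assume x: "x \<in> ?A"
    consider "norm x < r" | "x \<in> K" | "r / norm Q < norm x" by (force simp: K_def)
    then show "norm (f x) \<le> norm (f z)"
    proof cases
      case 1
      have "norm (x / Q) < b" using 1 r nQ by (simp add: norm_divide field_simps)
      then have "f x = f (x / Q)" using per[of "x / Q"] x Q by simp
      moreover have "r * norm Q < a" using r nQ by (simp add: field_simps)
      then have "x / Q \<in> K" using 1 x nQ by (simp add: K_def norm_divide field_simps)
      ultimately show ?thesis using z by simp
    next
      case 3
      then have "r < norm (Q * x)" using nQ by (simp add: norm_mult field_simps)
      moreover from this have "f (Q * x) = f x" using per[of x] x r by simp
      moreover have "norm Q * norm (Q * x) \<le> r"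
      proof -
        have "norm Q ^ 2 * norm x \<le> norm Q ^ 2 * b" using x by (intro mult_left_mono) auto
        then show ?thesis using ab r by (simp add: norm_mult power2_eq_square mult.assoc)
      qed
      then have "norm (Q * x) \<le> r / norm Q" using nQ by (simp add: field_simps)
      ultimately show ?thesis using z(2)[of "Q * x"] by (simp add: K_def)
    qed (use z in blast)
  qed
qed

text \<open>This is \<open>E(x) = (1 + x) / (1 - x) R(x; q)\<close>.\<close>

definition rank_quotient :: "complex \<Rightarrow> complex \<Rightarrow> complex" where
  "rank_quotient x q = (1 + x) * rank_num x q / qpoch_inf x q"

text \<open>Division by \<open>qpoch_inf x q\<close> absorbs the factor \<open>1 - x\<close> of the
  functional equation; the factors \<open>1 + x\<close> and \<open>1 + q * x\<close> are those built
  into \<open>rank_quotient\<close>.\<close>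

lemma rank_quotient_shift:
  assumes q: "norm q < 1" "q \<noteq> 0" and x: "norm x > 1" and nz: "qpoch_inf x q \<noteq> 0"
  shows "rank_quotient (q * x) q = 1 - q * x ^ 2 - q * x ^ 2 * rank_quotient x q"
proof -
  have s: "qpoch_inf x q = (1 - x) * qpoch_inf (q * x) q"
    using qpoch_inf_step[OF q(1), of x] by (simp add: mult_ac)
  have "1 - x \<noteq> 0" "qpoch_inf (q * x) q \<noteq> 0" using nz s by auto
  then have "rank_quotient (q * x) q
      = (1 - x) * (1 + q * x) * rank_num (q * x) q / qpoch_inf x q"
    by (simp add: rank_quotient_def s)
  also have "(1 - x) * (1 + q * x) * rank_num (q * x) q
      = (1 - q * x ^ 2) * qpoch_inf x q - q * x ^ 2 * ((1 + x) * rank_num x q)"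
    using rank_num_functional_equation[OF q x] by (simp add: algebra_simps)
  finally show ?thesis using nz by (simp add: rank_quotient_def diff_divide_distrib)
qed

text \<open>The annulus lies strictly between two consecutive circles of zeros: total exponents up
  to 2 give modulus above 1, those from 3 on modulus below 1.\<close>

lemma qpoch_inf_nonzero_annulus:
  assumes q: "norm q < 1" and x: "norm x < 1 / norm q ^ 3" "1 / norm q ^ 2 < norm x" and "k \<le> 2"
    and "q \<noteq> 0"
  shows "qpoch_inf (q ^ k * x) q \<noteq> 0"
proof (rule qpoch_inf_nonzero[OF q])
  fix n
  have q0: "norm q > 0" using assms by simp
  show "q ^ k * x * q ^ n \<noteq> 1"
  proof (cases "k + n \<le> 2")
    case True
    have "norm q ^ 2 \<le> norm q ^ (k + n)" using q True by (intro power_decreasing) auto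
    then have "norm q ^ 2 * norm x \<le> norm q ^ (k + n) * norm x" by (intro mult_right_mono) auto
    moreover have "1 < norm q ^ 2 * norm x" using x q0 by (simp add: field_simps)
    ultimately have "norm (q ^ k * x * q ^ n) > 1"
      by (simp add: norm_mult norm_power power_add mult_ac)
    then show ?thesis by auto
  next
    case False
    have "norm q ^ (k + n) \<le> norm q ^ 3" using q False by (intro power_decreasing) auto
    then have "norm q ^ (k + n) * norm x \<le> norm q ^ 3 * norm x" by (intro mult_right_mono) auto
    moreover have "norm q ^ 3 * norm x < 1" using x q0 by (simp add: field_simps)
    ultimately have "norm (q ^ k * x * q ^ n) < 1"
      by (simp add: norm_mult norm_power power_add mult_ac)
    then show ?thesis by auto
  qed
qed

text \<open>In this annulus \<open>x\<close>, \<open>q * x\<close> and \<open>q ^ 2 * x\<close> have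
  modulus above 1 and are no zeros of the denominator, so the one-step equation applies three
  times.\<close>

lemma rank_quotient_shift3:
  assumes q: "norm q < 1" "q \<noteq> 0" and x: "norm x < 1 / norm q ^ 3" "1 / norm q ^ 2 < norm x"
  shows "rank_quotient (q ^ 3 * x) q
    = 1 - 2 * q ^ 5 * x ^ 2 + 2 * q ^ 8 * x ^ 4 - q ^ 9 * x ^ 6 - q ^ 9 * x ^ 6 * rank_quotient x q"
proof -
  have q0: "norm q > 0" using q by simp
  have n: "norm (q ^ k * x) > 1" if "k \<le> 2" for k
  proof -
    have "norm q ^ 2 \<le> norm q ^ k" using q that by (intro power_decreasing) auto
    then have "norm q ^ 2 * norm x \<le> norm q ^ k * norm x" by (intro mult_right_mono) auto
    moreover have "1 < norm q ^ 2 * norm x" using x q0 by (simp add: field_simps)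
    ultimately show ?thesis by (simp add: norm_mult norm_power)
  qed
  have s: "rank_quotient (q * (q ^ k * x)) q
      = 1 - q * (q ^ k * x) ^ 2 - q * (q ^ k * x) ^ 2 * rank_quotient (q ^ k * x) q" if "k \<le> 2" for k
    using that by (intro rank_quotient_shift q n qpoch_inf_nonzero_annulus x)
  have "q ^ 3 * x = q * (q ^ 2 * x)" "q ^ 2 * x = q * (q ^ 1 * x)" "q ^ 1 * x = q * (q ^ 0 * x)"
    by (simp_all add: eval_nat_numeral)
  then show ?thesis
    using s[of 2] s[of 1] s[of 0] by (simp only: order_refl zero_le one_le_numeral)
      (simp add: algebra_simps eval_nat_numeral)
qed

text \<open>\<open>theta_j z q\<close> with the factors \<open>1 - z\<close> and
  \<open>qpoch_inf q q\<close> removed; it no longer vanishes at \<open>z = 1\<close>, which allows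
  evaluation at roots of unity.\<close>

definition theta_reduced :: "complex \<Rightarrow> complex \<Rightarrow> complex" where
  "theta_reduced z q = qpoch_inf (q * z) q * qpoch_inf (q / z) q"

lemma theta_j_eq_reduced:
  assumes "norm q < 1"
  shows "theta_j z q = (1 - z) * theta_reduced z q * qpoch_inf q q"
  using qpoch_inf_step[OF assms, of z] by (simp add: theta_j_def theta_reduced_def mult_ac)

lemma theta_reduced_nonzero:
  assumes "norm q < 1" "norm q < norm z" "norm (q * z) < 1"
  shows "theta_reduced z q \<noteq> 0"
proof -
  have "norm (q / z) < 1" using assms by (auto simp: norm_divide divide_less_eq)
  then show ?thesis
    using assms qpoch_inf_nonzero_norm by (simp add: theta_reduced_def)
qed

lemma primitive_cube_root:
  assumes "w ^ 2 + w + 1 = (0 :: complex)"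
  shows "w ^ 3 = 1" "norm w = 1" "(w ^ j * q) ^ 3 = q ^ 3" "norm (w ^ j * q) = norm q"
proof -
  show 1: "w ^ 3 = 1" using assms by algebra
  then show 2: "norm w = 1" using power_eq_1_iff[of w 3] by auto
  have "(w ^ j) ^ 3 = (w ^ 3) ^ j" by (simp flip: power_mult add: mult.commute)
  then show "(w ^ j * q) ^ 3 = q ^ 3" by (simp add: power_mult_distrib 1)
  show "norm (w ^ j * q) = norm q" by (simp add: norm_mult norm_power 2)
qed

text \<open>Since \<open>w\<^sup>2\<^sup>j = w\<^sup>-\<^sup>j\<close>, this is three times the part of \<open>f\<close> with exponents of \<open>q\<close> congruent to 1 modulo 3.\<close>

definition cube_root_sum :: "(complex \<Rightarrow> complex) \<Rightarrow> complex \<Rightarrow> complex \<Rightarrow> complex" where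
  "cube_root_sum f q w = (\<Sum>j<3. w ^ (2 * j) * f (w ^ j * q))"

lemma cube_root_sum_expand:
  "cube_root_sum f q w = f q + w ^ 2 * f (w * q) + w ^ 4 * f (w ^ 2 * q)"
  by (simp add: cube_root_sum_def lessThan_Suc eval_nat_numeral mult_ac)

text \<open>For a primitive cube root of unity \<open>w\<close> this is
  \<open>qpoch_inf ((q * x) ^ 3) (q ^ 3)\<close> times the rank generating function, with the common
  factor \<open>qpoch_inf (q * x) q\<close> cancelled.\<close>

definition cleared_rank :: "complex \<Rightarrow> complex \<Rightarrow> complex \<Rightarrow> complex" where
  "cleared_rank w x q = qpoch_inf (w * (q * x)) q * qpoch_inf (w ^ 2 * (q * x)) q * rank_num x q"

text \<open>Clearing the poles of \<open>rank_quotient\<close> by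
  \<open>qpoch_inf (x ^ 3) (q ^ 3)\<close> leaves three linear factors: two from the cube identity
  and \<open>1 + x\<close> from \<open>rank_quotient\<close>. They dictate the three theta functions
  in the elliptic quotient.\<close>

lemma cleared_rank_eq:
  assumes q: "norm q < 1" and w: "w ^ 2 + w + 1 = 0" and nz: "qpoch_inf x q \<noteq> 0"
  shows "(1 - w * x) * (1 - w ^ 2 * x) * (1 + x) * cleared_rank w x q
    = qpoch_inf (x ^ 3) (q ^ 3) * rank_quotient x q"
proof -
  have "qpoch_inf (w * x) q = (1 - w * x) * qpoch_inf (w * (q * x)) q"
    "qpoch_inf (w ^ 2 * x) q = (1 - w ^ 2 * x) * qpoch_inf (w ^ 2 * (q * x)) q"
    using qpoch_inf_step[OF q, of "w * x"] qpoch_inf_step[OF q, of "w ^ 2 * x"]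
    by (simp_all add: mult_ac)
  with qpoch_inf_cube[OF q w, of x] have "qpoch_inf (x ^ 3) (q ^ 3)
     = (1 - w * x) * (1 - w ^ 2 * x) * qpoch_inf (w * (q * x)) q * qpoch_inf (w ^ 2 * (q * x)) q
       * qpoch_inf x q"
    by (simp add: mult_ac)
  then show ?thesis using nz by (simp add: cleared_rank_def rank_quotient_def)
qed

text \<open>
  The quotient \<open>E\<^sub>1(x) j(x\<^sup>3; Q) / (j(\<omega>x; Q) j(\<omega>\<^sup>2x; Q) j(-x; Q))\<close> up to a constant, with the common zeros of
  numerator and denominator on \<open>|x| = 1\<close> already cancelled: the remaining denominator does not vanish
  in the annulus \<open>|q| < |x| < |q|\<^sup>-\<^sup>3\<close>.
\<close>

definition rank_elliptic :: "complex \<Rightarrow> complex \<Rightarrow> complex \<Rightarrow> complex" where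
  "rank_elliptic q w x = qpoch_inf (q ^ 3 / x ^ 3) (q ^ 3) * cube_root_sum (cleared_rank w x) q w
     / (theta_reduced (w * x) (q ^ 3) * theta_reduced (w ^ 2 * x) (q ^ 3) * theta_reduced (- x) (q ^ 3))"

context
  fixes q w :: complex
  assumes q: "0 < norm q" "norm q < 1" and w: "w ^ 2 + w + 1 = 0"
begin

lemma norm_cube_less: "norm (q ^ 3) < 1" "norm q ^ 3 < 1"
  using q by (auto simp: norm_power power_less_one_iff)

lemma theta_reduced_annulus_nonzero:
  assumes "norm q < norm x" "norm x < 1 / norm q ^ 3" "norm c = 1"
  shows "theta_reduced (c * x) (q ^ 3) \<noteq> 0"
proof (rule theta_reduced_nonzero)
  have "norm q ^ 3 \<le> norm q ^ 1" using q by (intro power_decreasing) auto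
  then show "norm (q ^ 3) < norm (c * x)" using assms by (simp add: norm_mult norm_power)
  show "norm (q ^ 3 * (c * x)) < 1" using assms q by (simp add: norm_mult norm_power field_simps)
qed (rule norm_cube_less)

text \<open>Puts the cancelled linear factors back, which expresses the quotient by full theta
  functions with their shift equations.\<close>

lemma rank_elliptic_theta:
  assumes x: "norm q < norm x" "norm x < 1 / norm q ^ 3"
    and nz: "\<And>j. qpoch_inf x (w ^ j * q) \<noteq> 0"
  shows "rank_elliptic q w x * (theta_j (w * x) (q ^ 3) * theta_j (w ^ 2 * x) (q ^ 3) * theta_j (- x) (q ^ 3))
    = theta_j (x ^ 3) (q ^ 3) * cube_root_sum (rank_quotient x) q w * qpoch_inf (q ^ 3) (q ^ 3) ^ 2"
proof -
  note w' = primitive_cube_root[OF w]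
  have t: "theta_reduced (w * x) (q ^ 3) \<noteq> 0" "theta_reduced (w ^ 2 * x) (q ^ 3) \<noteq> 0"
    "theta_reduced (- x) (q ^ 3) \<noteq> 0"
    using theta_reduced_annulus_nonzero[OF x, of w] theta_reduced_annulus_nonzero[OF x, of "w ^ 2"]
      theta_reduced_annulus_nonzero[OF x, of "-1"] by (simp_all add: w' norm_power)
  define D where "D = (1 - w * x) * (1 - w ^ 2 * x) * (1 + x)"
  have "D * cube_root_sum (cleared_rank w x) q w
      = qpoch_inf (x ^ 3) (q ^ 3) * cube_root_sum (rank_quotient x) q w"
  proof -
    have "D * cleared_rank w x (w ^ j * q) = qpoch_inf (x ^ 3) (q ^ 3) * rank_quotient x (w ^ j * q)" for j
      using cleared_rank_eq[OF _ w nz, of j] q unfolding D_def w' by simp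
    then show ?thesis
      by (simp only: cube_root_sum_def sum_distrib_left mult.left_commute[of D]
          mult.left_commute[of "qpoch_inf (x ^ 3) (q ^ 3)"])
  qed
  then have N: "D * (qpoch_inf (q ^ 3 / x ^ 3) (q ^ 3) * cube_root_sum (cleared_rank w x) q w) * qpoch_inf (q ^ 3) (q ^ 3) ^ 3
     = theta_j (x ^ 3) (q ^ 3) * cube_root_sum (rank_quotient x) q w * qpoch_inf (q ^ 3) (q ^ 3) ^ 2"
    by (simp add: theta_j_def power2_eq_square power3_eq_cube mult_ac)
  define R where "R = theta_reduced (w * x) (q ^ 3) * theta_reduced (w ^ 2 * x) (q ^ 3) * theta_reduced (- x) (q ^ 3)"
  have PR: "rank_elliptic q w x * R
     = qpoch_inf (q ^ 3 / x ^ 3) (q ^ 3) * cube_root_sum (cleared_rank w x) q w"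
    using t by (simp add: rank_elliptic_def R_def)
  have T: "theta_j (w * x) (q ^ 3) * theta_j (w ^ 2 * x) (q ^ 3) * theta_j (- x) (q ^ 3)
     = D * R * qpoch_inf (q ^ 3) (q ^ 3) ^ 3"
    unfolding theta_j_eq_reduced[OF norm_cube_less(1)] D_def R_def
    by (simp add: power3_eq_cube mult_ac)
  have "rank_elliptic q w x * (theta_j (w * x) (q ^ 3) * theta_j (w ^ 2 * x) (q ^ 3) * theta_j (- x) (q ^ 3))
     = D * (qpoch_inf (q ^ 3 / x ^ 3) (q ^ 3) * cube_root_sum (cleared_rank w x) q w) * qpoch_inf (q ^ 3) (q ^ 3) ^ 3"
    unfolding T PR[symmetric] by (simp only: mult_ac)
  then show ?thesis unfolding N .
qed

text \<open>With \<open>Q = q ^ 3\<close>, the three theta functions of the denominator acquire the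
  multiplier \<open>1 / x ^ 3\<close>. The numerator acquires \<open>- 1 / (Q ^ 3 * x ^ 9)\<close>
  from the theta function of \<open>x ^ 3\<close> and \<open>- Q ^ 3 * x ^ 6\<close> from the sum
  over conjugates, again \<open>1 / x ^ 3\<close> in total. The bounds place \<open>x\<close> in the
  annulus where the three-step equation is available.\<close>

lemma rank_elliptic_periodic:
  assumes x: "norm q < norm (q ^ 3 * x)" "norm x < 1 / norm q ^ 3"
  shows "rank_elliptic q w (q ^ 3 * x) = rank_elliptic q w x"
proof -
  note w' = primitive_cube_root[OF w]
  let ?Q = "q ^ 3"
  let ?T = "\<lambda>x. theta_j (w * x) ?Q * theta_j (w ^ 2 * x) ?Q * theta_j (- x) ?Q"
  let ?G = "\<lambda>x. cube_root_sum (rank_quotient x) q w"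
  have x2: "1 / norm q ^ 2 < norm x"
    using x q by (simp add: norm_mult norm_power field_simps power3_eq_cube power2_eq_square)
  have "1 / norm q ^ 2 > 1" using q by (simp add: power_less_one_iff)
  then have n1: "norm x > 1" using x2 by linarith
  then have x1: "norm x > 1" "x \<noteq> 0" "norm q < norm x" using q by auto
  have Qx: "norm (?Q * x) < 1" "norm (?Q * x) < 1 / norm q ^ 3"
  proof -
    show 1: "norm (?Q * x) < 1" using x q by (simp add: norm_mult norm_power field_simps)
    have "1 < 1 / norm q ^ 3" using norm_cube_less q by simp
    then show "norm (?Q * x) < 1 / norm q ^ 3" using 1 by linarith
  qed
  have w0: "w \<noteq> 0" using w'(2) by auto
  have nz: "qpoch_inf x (w ^ j * q) \<noteq> 0" for j
    using w0 qpoch_inf_nonzero_annulus[of "w ^ j * q" x 0] x x2 q by (auto simp: w')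
  have nzQ: "qpoch_inf (?Q * x) (w ^ j * q) \<noteq> 0" for j
    using qpoch_inf_nonzero_norm[of "w ^ j * q"] Qx(1) q by (simp add: w')
  have J: "qpoch_inf ?Q ?Q \<noteq> 0"
    by (intro qpoch_inf_nonzero_norm norm_cube_less)
  have T: "?T (?Q * x) = ?T x / x ^ 3"
  proof -
    have "theta_j (c * (?Q * x)) ?Q = - theta_j (c * x) ?Q / (c * x)" if "c \<noteq> 0" for c
      using theta_j_shift[OF norm_cube_less(1), of "c * x"] q x1 that by (simp add: mult_ac)
    from this[of w] this[of "w ^ 2"] this[of "-1"] w0
    have "?T (?Q * x) = (- theta_j (w * x) ?Q / (w * x)) * (- theta_j (w ^ 2 * x) ?Q / (w ^ 2 * x))
        * (theta_j (- x) ?Q / x)"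
      by simp
    also have "\<dots> = ?T x / (w ^ 3 * x ^ 3)"
      by (simp add: eval_nat_numeral mult_ac)
    finally show ?thesis by (simp only: w'(1) mult_1)
  qed
  have "?T x \<noteq> 0"
  proof -
    have "1 - c * x \<noteq> 0" if "norm c = 1" for c
    proof
      assume "1 - c * x = 0"
      then have "norm (c * x) = 1" by simp
      then show False using that x1 by (simp add: norm_mult)
    qed
    then have "theta_j (c * x) ?Q \<noteq> 0" if "norm c = 1" for c
      using theta_reduced_annulus_nonzero[OF x1(3) x(2)] J that
      unfolding theta_j_eq_reduced[OF norm_cube_less(1)] by simp
    from this[of w] this[of "w ^ 2"] this[of "-1"] show ?thesis
      by (simp add: w' norm_power)
  qed
  have G: "?G (?Q * x) = - (?Q ^ 3 * x ^ 6 * ?G x)"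
  proof -
    have r: "rank_quotient (?Q * x) (w ^ j * q) = 1 - 2 * (w ^ j * q) ^ 5 * x ^ 2
       + 2 * (w ^ j * q) ^ 8 * x ^ 4 - ?Q ^ 3 * x ^ 6 - ?Q ^ 3 * x ^ 6 * rank_quotient x (w ^ j * q)" for j
    proof -
      have "(w ^ j * q) ^ 9 = ((w ^ j * q) ^ 3) ^ 3" by (simp flip: power_mult)
      then have "(w ^ j * q) ^ 9 = ?Q ^ 3" by (simp only: w')
      then show ?thesis
        using rank_quotient_shift3[of "w ^ j * q" x] w0 x x2 q w' by auto
    qed
    define A B X where "A = 2 * q ^ 5 * x ^ 2" and "B = 2 * q ^ 8 * x ^ 4" and "X = ?Q ^ 3 * x ^ 6"
    have e0: "rank_quotient (?Q * x) q = 1 - A + B - X - X * rank_quotient x q"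
      using r[of 0] by (simp add: A_def B_def X_def)
    have e1: "rank_quotient (?Q * x) (w * q) = 1 - w ^ 5 * A + w ^ 8 * B - X - X * rank_quotient x (w * q)"
      using r[of 1] by (simp add: A_def B_def X_def power_mult_distrib mult_ac)
    have e2: "rank_quotient (?Q * x) (w ^ 2 * q)
        = 1 - w ^ 10 * A + w ^ 16 * B - X - X * rank_quotient x (w ^ 2 * q)"
      using r[of 2] by (simp add: A_def B_def X_def power_mult_distrib mult_ac flip: power_mult)
    have "?G (?Q * x) + X * ?G x
       = (1 + w ^ 2 + w ^ 4) * (1 - X) - A * (1 + w ^ 7 + w ^ 14) + B * (1 + w ^ 10 + w ^ 20)"
      unfolding cube_root_sum_expand e0 e1 e2 by (simp add: algebra_simps)
    \<comment> \<open>The exponents combine the weights \<open>w ^ 2\<close>, \<open>w ^ 4\<close>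
      with the conjugates of \<open>q ^ 5\<close> and \<open>q ^ 8\<close>: 7 = 2 + 5, 14 = 4 + 10,
      10 = 2 + 8, 20 = 4 + 16. As 3 divides none of 2, 7, 10, each sum runs over all cube roots of
      unity.\<close>
    moreover have "1 + w ^ 2 + w ^ 4 = 0" "1 + w ^ 7 + w ^ 14 = 0" "1 + w ^ 10 + w ^ 20 = 0"
    proof -
      have "w ^ 4 = w ^ 3 * w" "w ^ 7 = (w ^ 3) ^ 2 * w" "w ^ 10 = (w ^ 3) ^ 3 * w"
        "w ^ 14 = (w ^ 3) ^ 4 * w ^ 2" "w ^ 20 = (w ^ 3) ^ 6 * w ^ 2"
        by (simp_all flip: power_mult power_add power_Suc2)
      then show "1 + w ^ 2 + w ^ 4 = 0" "1 + w ^ 7 + w ^ 14 = 0" "1 + w ^ 10 + w ^ 20 = 0"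
        using w by (simp_all add: w'(1) add_ac)
    qed
    ultimately show ?thesis by (simp add: eq_neg_iff_add_eq_0 X_def)
  qed
  define X where "X = ?Q ^ 3 * x ^ 6"
  have X0: "X \<noteq> 0" using q x1 by (simp add: X_def)
  \<comment> \<open>The argument is multiplied by \<open>?Q ^ 3\<close>, so the shift equation is
    used three times.\<close>
  have th: "theta_j ((?Q * x) ^ 3) ?Q = - theta_j (x ^ 3) ?Q / (X * x ^ 3)"
  proof -
    have s: "theta_j (?Q * y) ?Q = - theta_j y ?Q / y" if "y \<noteq> 0" for y
      using theta_j_shift[OF norm_cube_less(1)] q that by simp
    have nz: "x ^ 3 \<noteq> 0" "?Q * x ^ 3 \<noteq> 0" "?Q * (?Q * x ^ 3) \<noteq> 0" using q x1 by auto
    have "(?Q * x) ^ 3 = ?Q * (?Q * (?Q * x ^ 3))" by (simp add: power_mult_distrib power3_eq_cube mult_ac)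
    then have "theta_j ((?Q * x) ^ 3) ?Q
        = - (- (- theta_j (x ^ 3) ?Q / x ^ 3) / (?Q * x ^ 3)) / (?Q * (?Q * x ^ 3))"
      by (simp only: s[OF nz(3)] s[OF nz(2)] s[OF nz(1)])
    also have "\<dots> = - theta_j (x ^ 3) ?Q / (x ^ 3 * (?Q * x ^ 3) * (?Q * (?Q * x ^ 3)))"
      by simp
    also have "x ^ 3 * (?Q * x ^ 3) * (?Q * (?Q * x ^ 3)) = X * x ^ 3"
      by (simp add: X_def power3_eq_cube[of "q ^ 3"] mult_ac flip: power_add)
    finally show ?thesis .
  qed
  have "rank_elliptic q w (?Q * x) * ?T (?Q * x)
      = theta_j ((?Q * x) ^ 3) ?Q * ?G (?Q * x) * qpoch_inf ?Q ?Q ^ 2"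
    by (rule rank_elliptic_theta) (use x Qx nzQ in auto)
  also have "\<dots> = theta_j (x ^ 3) ?Q * ?G x * qpoch_inf ?Q ?Q ^ 2 / x ^ 3"
    unfolding th G X_def[symmetric] using X0 by simp
  also have "\<dots> = rank_elliptic q w x * ?T x / x ^ 3"
    using rank_elliptic_theta[OF x1(3) x(2) nz] by simp
  also have "\<dots> = rank_elliptic q w x * ?T (?Q * x)"
    unfolding T by simp
  finally show ?thesis
    using \<open>?T x \<noteq> 0\<close> x1 by (simp add: T)
qed

text \<open>The annulus contains a full period of the shift by \<open>q ^ 3\<close>, and also both
  the unit circle and the point \<open>1 / q\<close>.\<close>

lemma rank_elliptic_constant:
  "rank_elliptic q w constant_on {x. norm q < norm x \<and> norm x < 1 / norm q ^ 3}"
proof (rule holomorphic_multiplicatively_periodic_constant[where Q = "q ^ 3"])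
  note w' = primitive_cube_root[OF w]
  let ?A = "{x. norm q < norm x \<and> norm x < 1 / norm q ^ 3}"
  have n: "x \<noteq> 0" if "x \<in> ?A" for x
    using that by auto
  have "(\<lambda>x. cube_root_sum (cleared_rank w x) q w) holomorphic_on ?A"
    unfolding cube_root_sum_def cleared_rank_def
  proof (intro holomorphic_intros)
    fix j
    show "(\<lambda>x. rank_num x (w ^ j * q)) holomorphic_on ?A"
      by (rule holomorphic_on_subset[OF holomorphic_rank_num]) (use q in \<open>auto simp: w'\<close>)
  qed (use q in \<open>auto simp: w'\<close>)
  moreover have "w \<noteq> 0" using w'(2) by auto
  moreover have th: "(\<lambda>x. theta_reduced (c * x) (q ^ 3)) holomorphic_on ?A" if "c \<noteq> 0" for c
    unfolding theta_reduced_def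
    by (intro holomorphic_intros norm_cube_less) (use n that in auto)
  ultimately have "(\<lambda>x. cube_root_sum (cleared_rank w x) q w) holomorphic_on ?A"
    "(\<lambda>x. theta_reduced (w * x) (q ^ 3)) holomorphic_on ?A"
    "(\<lambda>x. theta_reduced (w ^ 2 * x) (q ^ 3)) holomorphic_on ?A"
    "(\<lambda>x. theta_reduced (- x) (q ^ 3)) holomorphic_on ?A"
    using th[of w] th[of "w ^ 2"] th[of "-1"] by auto
  moreover have "theta_reduced (w * x) (q ^ 3) * theta_reduced (w ^ 2 * x) (q ^ 3) * theta_reduced (- x) (q ^ 3) \<noteq> 0"
    if "x \<in> ?A" for x
    using theta_reduced_annulus_nonzero[of x w] theta_reduced_annulus_nonzero[of x "w ^ 2"]
      theta_reduced_annulus_nonzero[of x "-1"] that by (simp add: w' norm_power)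
  moreover have "(\<lambda>x. qpoch_inf (q ^ 3 / x ^ 3) (q ^ 3)) holomorphic_on ?A"
    by (intro holomorphic_intros norm_cube_less) (use n in auto)
  ultimately show "rank_elliptic q w holomorphic_on ?A"
    unfolding rank_elliptic_def by (intro holomorphic_on_divide holomorphic_on_mult) auto
  show "norm q < norm (q ^ 3) * (1 / norm q ^ 3)"
    using q by (simp add: norm_power)
  show "norm (q ^ 3) ^ 2 * (1 / norm q ^ 3) \<le> norm q"
  proof -
    have "norm (q ^ 3) ^ 2 * (1 / norm q ^ 3) = norm q ^ 3"
      using q by (simp add: norm_power field_simps flip: power_add power_mult)
    also have "\<dots> \<le> norm q ^ 1" using q by (intro power_decreasing) auto
    finally show ?thesis by simp
  qed
qed (use q norm_cube_less rank_elliptic_periodic in auto)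

end

section \<open>Evaluation at \<open>1/q\<close> and at the sixth roots of unity\<close>

text \<open>A case of the \<open>q\<close>-binomial theorem in which the partial sums have a closed form.\<close>

lemma sums_qpoch_quotient:
  assumes q: "norm q < 1"
  shows "(\<lambda>m. q ^ (2 * m) * (qpoch (- 1) q m / qpoch q q m)) sums
    ((1 - q) / (1 + q) * (qpoch_inf (- q) q / qpoch_inf q q))"
proof -
  let ?W = "\<lambda>n. qpoch (- q) q n / qpoch q q n"
  have q1: "1 + q \<noteq> 0"
  proof
    assume "1 + q = 0"
    then have "q = -1" by (simp add: eq_neg_iff_add_eq_0 add.commute)
    then show False using q by simp
  qed
  have "norm (q ^ Suc n) < 1" for n using q power_Suc_less_one[of "norm q" n] by (cases "q = 0") (simp_all add: norm_mult norm_power)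
  then have nz: "1 - q * q ^ n \<noteq> 0" for n by (metis eq_iff_diff_eq_0 norm_one order_less_irrefl power_Suc)
  then have nzp: "qpoch q q n \<noteq> 0" for n by (induction n) (simp_all add: qpoch_Suc)
  have part: "(\<Sum>m<Suc n. q ^ (2 * m) * (qpoch (- 1) q m / qpoch q q m))
      = (2 * q ^ Suc n + (1 - q)) / (1 + q) * ?W n" for n
  proof (induction n)
    case (Suc n)
    \<comment> \<open>In terms of \<open>p\<close> the induction step is a rational
      identity.\<close>
    define p where "p = q ^ n"
    have "1 - q * p \<noteq> 0" using nz[of n] by (simp add: p_def)
    then have eq: "(2 * q * p + (1 - q)) / (1 + q) + 2 * (q * p) ^ 2 / (1 - q * p)
        = (2 * q * (q * p) + (1 - q)) / (1 + q) * ((1 + q * p) / (1 - q * p))"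
      using q1 by (simp add: add_frac_eq) (simp add: algebra_simps power2_eq_square)
    \<comment> \<open>The factor 2 comes from
      \<open>qpoch (- 1) q (Suc n) = 2 * qpoch (- q) q n\<close>.\<close>
    have "(\<Sum>m<Suc (Suc n). q ^ (2 * m) * (qpoch (- 1) q m / qpoch q q m))
        = (2 * q ^ Suc n + (1 - q)) / (1 + q) * ?W n
          + q ^ (2 * Suc n) * (2 * qpoch (- q) q n / qpoch q q (Suc n))"
      using Suc by (simp add: qpoch_Suc_shift[of "-1"])
    also have "\<dots> = ((2 * q * p + (1 - q)) / (1 + q) + 2 * (q * p) ^ 2 / (1 - q * p)) * ?W n"
    proof -
      have e1: "q ^ (2 * Suc n) = (q * p) ^ 2" by (simp add: p_def power_even_eq power_mult_distrib power2_eq_square)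
      have e2: "2 * q ^ Suc n = 2 * q * p" by (simp add: p_def)
      have e3: "2 * qpoch (- q) q n / qpoch q q (Suc n) = 2 / (1 - q * p) * ?W n"
        by (simp add: qpoch_Suc p_def)
      show ?thesis unfolding e1 e2 e3 distrib_right by simp
    qed
    also have "\<dots> = (2 * q * (q * p) + (1 - q)) / (1 + q) * ((1 + q * p) / (1 - q * p)) * ?W n"
      unfolding eq ..
    also have "\<dots> = (2 * q ^ Suc (Suc n) + (1 - q)) / (1 + q) * ?W (Suc n)"
      by (simp add: qpoch_Suc p_def mult_ac)
    finally show ?case .
  qed (use q1 in simp)
  have "(\<lambda>n. (2 * q ^ Suc n + (1 - q)) / (1 + q) * ?W n) \<longlonglongrightarrow>
      (2 * 0 + (1 - q)) / (1 + q) * (qpoch_inf (- q) q / qpoch_inf q q)"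
    using q by (intro tendsto_intros LIMSEQ_Suc[OF LIMSEQ_power_zero] qpoch_tendsto q1 qpoch_inf_nonzero_norm)
  then have "(\<lambda>n. \<Sum>m<Suc n. q ^ (2 * m) * (qpoch (- 1) q m / qpoch q q m)) \<longlonglongrightarrow>
      (1 - q) / (1 + q) * (qpoch_inf (- q) q / qpoch_inf q q)"
    unfolding part mult_zero_right add_0_left .
  then show ?thesis
    unfolding sums_def by (rule LIMSEQ_imp_Suc)
qed

text \<open>At \<open>x = 1 / q\<close> the leading product is \<open>qpoch_inf 1 q = 0\<close>, and
  the series becomes the one just summed.\<close>

lemma rank_num_inverse:
  assumes q: "norm q < 1" "q \<noteq> 0"
  shows "rank_num (1 / q) q = 2 * q * ((1 - q) / (1 + q)) * qpoch_inf (- q) q"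
proof -
  have nz: "qpoch_inf q q \<noteq> 0" by (intro qpoch_inf_nonzero_norm q)
  have "q ^ Suc m / (1 / q) ^ m * (qpoch (- q * (1 / q)) q m * qpoch_inf (q ^ (m + 2) * (1 / q)) q)
      = q * qpoch_inf q q * (q ^ (2 * m) * (qpoch (- 1) q m / qpoch q q m))" for m
  proof -
    have 1: "qpoch_inf q q = qpoch q q m * qpoch_inf (q ^ (m + 2) * (1 / q)) q"
      using qpoch_inf_split[OF q(1), of q m] q(2) by simp
    then have 2: "qpoch q q m \<noteq> 0" using nz by auto
    have 3: "q ^ Suc m / (1 / q) ^ m = q * q ^ (2 * m)"
      by (simp add: power_divide mult_2 power_add)
    have 4: "- q * (1 / q) = - 1" using q(2) by simp
    show ?thesis unfolding 3 4 1 using 2 by simp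
  qed
  then have "(\<Sum>m. q ^ Suc m / (1 / q) ^ m * (qpoch (- q * (1 / q)) q m * qpoch_inf (q ^ (m + 2) * (1 / q)) q))
      = q * qpoch_inf q q * ((1 - q) / (1 + q) * (qpoch_inf (- q) q / qpoch_inf q q))"
    using sums_mult[OF sums_qpoch_quotient[OF q(1)], of "q * qpoch_inf q q"] by (simp add: sums_iff)
  then show ?thesis
    unfolding rank_num_def using q nz by simp
qed

text \<open>Formed without the factor \<open>(1 + x) / (1 - x)\<close>, so that it is meaningful at
  \<open>x = 1\<close> and keeps its information at \<open>x = - 1\<close>.\<close>

definition rank_class :: "complex \<Rightarrow> complex \<Rightarrow> complex \<Rightarrow> complex" where
  "rank_class q w x = cube_root_sum (\<lambda>r. rank_num x r / qpoch_inf (r * x) r) q w"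

context
  fixes q w :: complex
  assumes q: "0 < norm q" "norm q < 1" and w: "w ^ 2 + w + 1 = 0"
begin

lemma qpoch_inf_Q_nonzero:
  assumes "0 < k"
  shows "qpoch_inf ((q ^ 3) ^ k) ((q ^ 3) ^ k) \<noteq> 0"
  by (rule qpoch_inf_nonzero_norm)
    (use assms q in \<open>simp_all add: norm_power power_less_one_iff flip: power_mult\<close>)

text \<open>For the nomes \<open>w * q\<close> and \<open>w ^ 2 * q\<close> the cleared series at
  \<open>1 / q\<close> contains \<open>qpoch_inf 1\<close>, hence vanishes, and only
  \<open>q\<close> itself contributes. The rest is cancellation among products of nome
  \<open>q ^ 3\<close> and \<open>q ^ 9\<close>.\<close>

lemma rank_elliptic_inverse:
  "rank_elliptic q w (1 / q) = 6 * q * qpoch_inf (- (q ^ 3)) (q ^ 3) * qpoch_inf ((q ^ 3) ^ 3) ((q ^ 3) ^ 3)"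
proof -
  note w' = primitive_cube_root[OF w]
  define Q where "Q = q ^ 3"
  have Q: "norm Q < 1" "norm (Q ^ 3) < 1"
    using q by (simp_all add: Q_def norm_power power_less_one_iff flip: power_mult)
  have q0: "q \<noteq> 0" using q by auto
  define A B where "A i = qpoch_inf (q ^ i) Q" and "B i = qpoch_inf (- (q ^ i)) Q" for i
  define D where "D i = qpoch_inf (Q ^ i) (Q ^ 3)" for i
  have nq: "norm (q ^ i) < 1" "norm (Q ^ i) < 1" if "i > 0" for i
    using that q Q by (simp_all add: norm_power power_less_one_iff)
  have A0: "A i \<noteq> 0" "B i \<noteq> 0" "D i \<noteq> 0" if "i > 0" for i
    using nq[OF that] Q by (simp_all add: A_def B_def D_def qpoch_inf_nonzero_norm)
  have one: "1 - q \<noteq> 0" "1 + q \<noteq> 0" "1 - Q \<noteq> 0"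
    using q Q by (auto simp: eq_neg_iff_add_eq_0[symmetric] add.commute[of 1])
  have step: "A 1 = (1 - q) * A 4" "B 1 = (1 + q) * B 4" "D 1 = (1 - Q) * D 4" "A 3 = (1 - Q) * A 6"
    using qpoch_inf_step[OF Q(1), of q] qpoch_inf_step[OF Q(1), of "- q"]
      qpoch_inf_step[OF Q(2), of Q] qpoch_inf_step[OF Q(1), of Q]
    by (simp_all add: A_def B_def D_def Q_def eval_nat_numeral mult_ac)
  have cube: "A 2 * qpoch_inf (w * q ^ 2) Q * qpoch_inf (w ^ 2 * q ^ 2) Q = D 2"
    "A 4 * qpoch_inf (w * q ^ 4) Q * qpoch_inf (w ^ 2 * q ^ 4) Q = D 4"
    using qpoch_inf_cube[OF Q(1) w, of "q ^ 2"] qpoch_inf_cube[OF Q(1) w, of "q ^ 4"]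
    by (simp_all add: A_def D_def Q_def flip: power_mult)
  have dis: "qpoch_inf q q = A 1 * A 2 * A 3" "qpoch_inf (- q) q = B 1 * B 2 * B 3" "A 3 = D 1 * D 2 * D 3"
    using qpoch_inf_dissect[OF q(2), of 3 q] qpoch_inf_dissect[OF q(2), of 3 "- q"]
      qpoch_inf_dissect[OF Q(1), of 3 Q]
    by (simp_all add: A_def B_def D_def Q_def eval_nat_numeral lessThan_Suc mult_ac)
  have w12: "(1 - w) * (1 - w ^ 2) = 3" using w by algebra
  have "cube_root_sum (cleared_rank w (1 / q)) q w
      = qpoch_inf w q * qpoch_inf (w ^ 2) q * rank_num (1 / q) q"
  proof -
    have "norm (w * q) < 1" "norm (w ^ 2 * q) < 1" using q w' by (simp_all add: norm_mult norm_power)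
    moreover have "w * (w * q * (1 / q)) = w ^ 2" "w ^ 2 * (w * q * (1 / q)) = 1"
      "w * (w ^ 2 * q * (1 / q)) = 1"
      using q0 w'(1) by (simp_all add: power2_eq_square power3_eq_cube mult_ac)
    ultimately have z: "cleared_rank w (1 / q) (w * q) = 0" "cleared_rank w (1 / q) (w ^ 2 * q) = 0"
      unfolding cleared_rank_def by (simp_all only: qpoch_inf_1 mult_zero_left mult_zero_right)
    show ?thesis using q0 unfolding cube_root_sum_expand z by (simp add: cleared_rank_def)
  qed
  \<comment> \<open>The 3 is \<open>(1 - w) * (1 - w ^ 2)\<close>; with the 2 from
    \<open>rank_num_inverse\<close> it yields the 6.\<close>
  also have "qpoch_inf w q * qpoch_inf (w ^ 2) q = 3 * (qpoch_inf (w * q) q * qpoch_inf (w ^ 2 * q) q)"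
    using qpoch_inf_step[OF q(2), of w] qpoch_inf_step[OF q(2), of "w ^ 2"] w12
    by (simp flip: w12 add: mult_ac)
  also have "qpoch_inf (w * q) q * qpoch_inf (w ^ 2 * q) q = A 3 / (A 1 * A 2 * A 3)"
  proof -
    have "qpoch_inf q q * (qpoch_inf (w * q) q * qpoch_inf (w ^ 2 * q) q) = A 3"
      using qpoch_inf_cube[OF q(2) w, of q] by (simp add: A_def Q_def mult_ac)
    then show ?thesis
      using A0[of 1] A0[of 2] A0[of 3] unfolding dis(1) by (simp add: field_simps)
  qed
  also have "rank_num (1 / q) q = 2 * q * ((1 - q) / (1 + q)) * (B 1 * B 2 * B 3)"
    using rank_num_inverse[OF q(2) q0] dis(2) by simp
  finally have num: "cube_root_sum (cleared_rank w (1 / q)) q w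
      = 3 * (A 3 / (A 1 * A 2 * A 3)) * (2 * q * ((1 - q) / (1 + q)) * (B 1 * B 2 * B 3))" .
  have "theta_reduced (w * (1 / q)) Q * theta_reduced (w ^ 2 * (1 / q)) Q * theta_reduced (- (1 / q)) Q
      = (D 2 / A 2) * (D 4 / A 4) * (B 2 * B 4)"
  proof -
    have "Q * (c * (1 / q)) = c * q ^ 2" "Q / (c * (1 / q)) = q ^ 4 / c" if "c \<noteq> 0" for c
      using q0 that by (simp_all add: Q_def eval_nat_numeral field_simps)
    then have t: "theta_reduced (c * (1 / q)) Q = qpoch_inf (c * q ^ 2) Q * qpoch_inf (q ^ 4 / c) Q" if "c \<noteq> 0" for c
      using that by (simp add: theta_reduced_def)
    have w0: "w \<noteq> 0" using w'(2) by auto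
    have "q ^ 4 / w = w ^ 2 * q ^ 4" "q ^ 4 / w ^ 2 = w * q ^ 4"
      using w'(1) w0 by (simp_all add: divide_eq_eq power2_eq_square power3_eq_cube mult_ac)
    then have "theta_reduced (w * (1 / q)) Q = qpoch_inf (w * q ^ 2) Q * qpoch_inf (w ^ 2 * q ^ 4) Q"
      "theta_reduced (w ^ 2 * (1 / q)) Q = qpoch_inf (w ^ 2 * q ^ 2) Q * qpoch_inf (w * q ^ 4) Q"
      "theta_reduced (- (1 / q)) Q = B 2 * B 4"
      using t[of w] t[of "w ^ 2"] t[of "-1"] w0 by (simp_all add: B_def)
    moreover have "D 2 / A 2 = qpoch_inf (w * q ^ 2) Q * qpoch_inf (w ^ 2 * q ^ 2) Q"
      "D 4 / A 4 = qpoch_inf (w * q ^ 4) Q * qpoch_inf (w ^ 2 * q ^ 4) Q"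
      using A0[of 2] A0[of 4] by (simp_all flip: cube)
    ultimately show ?thesis by (simp only: mult_ac)
  qed
  moreover have "qpoch_inf (q ^ 3 / (1 / q) ^ 3) Q = A 6"
    using q0 by (simp add: A_def power_divide flip: power_add)
  ultimately have "rank_elliptic q w (1 / q) = A 6 *
      (3 * (A 3 / (A 1 * A 2 * A 3)) * (2 * q * ((1 - q) / (1 + q)) * (B 1 * B 2 * B 3)))
      / ((D 2 / A 2) * (D 4 / A 4) * (B 2 * B 4))"
    unfolding rank_elliptic_def num Q_def by simp
  also have "\<dots> = 6 * q * B 3 * D 3"
  proof -
    have a6: "A 6 = D 4 * D 2 * D 3"
      using step(3,4) dis(3) one(3) by (simp add: mult.assoc)
    have nz: "A 2 \<noteq> 0" "A 4 \<noteq> 0" "A 3 \<noteq> 0" "B 2 \<noteq> 0" "B 4 \<noteq> 0" "D 2 \<noteq> 0" "D 4 \<noteq> 0"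
      by (auto simp: A0)
    \<comment> \<open>\<open>u\<close> and \<open>v\<close> stand for \<open>1 - q\<close> and
      \<open>1 + q\<close>, which makes this a cancellation of atoms.\<close>
    have "D 4 * D 2 * D 3 * (3 * (A 3 / (u * A 4 * A 2 * A 3)) * (2 * q * (u / v) * (v * B 4 * B 2 * B 3)))
        / (D 2 / A 2 * (D 4 / A 4) * (B 2 * B 4)) = 6 * q * B 3 * D 3" if "u \<noteq> 0" "v \<noteq> 0" for u v
      using nz that by (simp add: field_simps)
    from this[OF one(1,2)] show ?thesis unfolding step(1,2) a6 .
  qed
  finally show ?thesis by (simp add: B_def D_def Q_def)
qed

text \<open>The reduced form stays valid at the cube roots of unity and at \<open>- 1\<close>, where
  the linear factors of the full theta functions vanish.\<close>

lemma rank_elliptic_unit_circle: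
  assumes x: "norm x = 1"
  shows "rank_elliptic q w x * (theta_reduced (w * x) (q ^ 3) * theta_reduced (w ^ 2 * x) (q ^ 3) * theta_reduced (- x) (q ^ 3))
     = theta_reduced (x ^ 3) (q ^ 3) * rank_class q w x"
proof -
  note w' = primitive_cube_root[OF w]
  have annulus: "norm q < norm x" "norm x < 1 / norm q ^ 3"
    using x q by (simp_all add: power_less_one_iff)
  have t: "theta_reduced (w * x) (q ^ 3) \<noteq> 0" "theta_reduced (w ^ 2 * x) (q ^ 3) \<noteq> 0"
    "theta_reduced (- x) (q ^ 3) \<noteq> 0"
    using theta_reduced_annulus_nonzero[OF q w annulus, of w] theta_reduced_annulus_nonzero[OF q w annulus, of "w ^ 2"]
      theta_reduced_annulus_nonzero[OF q w annulus, of "-1"] by (simp_all add: w' norm_power)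
  have "cleared_rank w x (w ^ j * q)
      = qpoch_inf (q ^ 3 * x ^ 3) (q ^ 3) * (rank_num x (w ^ j * q) / qpoch_inf (w ^ j * q * x) (w ^ j * q))" for j
  proof -
    have n: "norm (w ^ j * q) < 1" "norm (w ^ j * q * x) < 1"
      using q x w'(4)[of j q] by (simp_all only: norm_mult[of _ x] mult_1_right)
    have "(w ^ j * q * x) ^ 3 = q ^ 3 * x ^ 3" by (simp only: power_mult_distrib[of _ x] w')
    with qpoch_inf_cube[OF n(1) w, of "w ^ j * q * x"]
    have "qpoch_inf (q ^ 3 * x ^ 3) (q ^ 3) = qpoch_inf (w ^ j * q * x) (w ^ j * q) *
        qpoch_inf (w * (w ^ j * q * x)) (w ^ j * q) * qpoch_inf (w ^ 2 * (w ^ j * q * x)) (w ^ j * q)"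
      by (simp only: w')
    then show ?thesis using qpoch_inf_nonzero_norm[OF n] unfolding cleared_rank_def by simp
  qed
  then have "cube_root_sum (cleared_rank w x) q w = qpoch_inf (q ^ 3 * x ^ 3) (q ^ 3) * rank_class q w x"
    unfolding rank_class_def cube_root_sum_def sum_distrib_left
    by (simp only: mult.left_commute[of "qpoch_inf (q ^ 3 * x ^ 3) (q ^ 3)"])
  then show ?thesis
    using t by (simp add: rank_elliptic_def theta_reduced_def[of "x ^ 3"] mult_ac)
qed

lemma rank_class_eq:
  assumes x: "norm x = 1"
  shows "rank_class q w x = 6 * q * qpoch_inf (- (q ^ 3)) (q ^ 3) * qpoch_inf ((q ^ 3) ^ 3) ((q ^ 3) ^ 3) *
     (theta_reduced (w * x) (q ^ 3) * theta_reduced (w ^ 2 * x) (q ^ 3) * theta_reduced (- x) (q ^ 3))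
     / theta_reduced (x ^ 3) (q ^ 3)"
proof -
  have Q: "norm (q ^ 3) < 1" "norm q ^ 3 < 1" using q by (simp_all add: norm_power power_less_one_iff)
  have "theta_reduced (x ^ 3) (q ^ 3) \<noteq> 0"
    by (rule theta_reduced_nonzero) (use x Q in \<open>simp_all add: norm_mult norm_power\<close>)
  moreover have "rank_elliptic q w x = rank_elliptic q w (1 / q)"
  proof -
    have "norm q ^ 3 < norm q ^ 1" using q by (intro power_strict_decreasing) auto
    then have "1 / norm q < 1 / norm q ^ 3" using q by (intro divide_strict_left_mono) auto
    moreover have "norm q < 1 / norm q"
      using q mult_strict_mono[of "norm q" 1 "norm q" 1] by (simp add: field_simps)
    moreover have "norm q < norm x" "norm x < 1 / norm q ^ 3"
      using x q Q by simp_all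
    moreover obtain c where "\<And>y. norm q < norm y \<Longrightarrow> norm y < 1 / norm q ^ 3 \<Longrightarrow> rank_elliptic q w y = c"
      using rank_elliptic_constant[OF q w] unfolding constant_on_def by blast
    ultimately show ?thesis by (simp add: norm_divide)
  qed
  ultimately show ?thesis
    using rank_elliptic_unit_circle[OF x] by (simp add: rank_elliptic_inverse field_simps)
qed

text \<open>Since \<open>1 / w = w ^ 2\<close>, the two factors of \<open>theta_reduced\<close> at
  \<open>w\<close> are those that the cube identity leaves over; the signs are handled by the square
  identity.\<close>

lemma theta_reduced_values:
  defines "Q \<equiv> q ^ 3"
  shows "theta_reduced 1 Q = J_m 1 Q ^ 2" "theta_reduced (- 1) Q = (J_m 2 Q / J_m 1 Q) ^ 2"
    "theta_reduced w Q = J_m 3 Q / J_m 1 Q" "theta_reduced (w ^ 2) Q = J_m 3 Q / J_m 1 Q"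
    "theta_reduced (- w) Q = J_m 6 Q * J_m 1 Q / (J_m 3 Q * J_m 2 Q)" "theta_reduced (- (w ^ 2)) Q = J_m 6 Q * J_m 1 Q / (J_m 3 Q * J_m 2 Q)"
    "qpoch_inf (- Q) Q = J_m 2 Q / J_m 1 Q"
proof -
  note w' = primitive_cube_root[OF w]
  have Q: "norm Q < 1" "norm (Q ^ 3) < 1" using q by (simp_all add: Q_def norm_power power_less_one_iff)
  have J: "J_m k Q \<noteq> 0" if "k > 0" for k
    using qpoch_inf_Q_nonzero[OF that] by (simp add: J_m_def Q_def)
  show neg: "qpoch_inf (- Q) Q = J_m 2 Q / J_m 1 Q"
    using qpoch_inf_square[OF Q(1), of Q] J[of 1] by (simp add: J_m_def field_simps)
  have neg3: "qpoch_inf (- (Q ^ 3)) (Q ^ 3) = J_m 6 Q / J_m 3 Q"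
    using qpoch_inf_square[OF Q(2), of "Q ^ 3"] J[of 3] by (simp add: J_m_def field_simps flip: power_mult)
  have w1: "qpoch_inf (w * Q) Q * qpoch_inf (w ^ 2 * Q) Q = J_m 3 Q / J_m 1 Q"
    using qpoch_inf_cube[OF Q(1) w, of Q] J[of 1] by (simp add: J_m_def field_simps)
  have w2: "qpoch_inf (w * - Q) Q * qpoch_inf (w ^ 2 * - Q) Q = J_m 6 Q * J_m 1 Q / (J_m 3 Q * J_m 2 Q)"
    using qpoch_inf_cube[OF Q(1) w, of "- Q"] J[of 1] J[of 2] J[of 3] neg
    by (simp add: neg3 field_simps)
  have w0: "w \<noteq> 0" using w'(2) by auto
  then have inv: "Q / w = w ^ 2 * Q" "Q / w ^ 2 = w * Q"
    using w'(1) by (simp_all add: divide_eq_eq power2_eq_square power3_eq_cube mult_ac)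
  show "theta_reduced 1 Q = J_m 1 Q ^ 2" "theta_reduced (- 1) Q = (J_m 2 Q / J_m 1 Q) ^ 2"
    unfolding theta_reduced_def by (simp add: J_m_def power2_eq_square, simp add: neg power2_eq_square)
  show "theta_reduced w Q = J_m 3 Q / J_m 1 Q" "theta_reduced (w ^ 2) Q = J_m 3 Q / J_m 1 Q"
    using w1 by (simp_all add: theta_reduced_def inv mult_ac)
  show "theta_reduced (- w) Q = J_m 6 Q * J_m 1 Q / (J_m 3 Q * J_m 2 Q)" "theta_reduced (- (w ^ 2)) Q = J_m 6 Q * J_m 1 Q / (J_m 3 Q * J_m 2 Q)"
    using w2 by (simp_all add: theta_reduced_def inv mult_ac)
qed

lemma rank_class_values:
  shows "rank_class q w 1 = 6 * q * (J_m 2 (q ^ 3) ^ 3 * J_m 3 (q ^ 3) ^ 3 / J_m 1 (q ^ 3) ^ 7)"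
    "rank_class q w (- 1) = 6 * q * (J_m 1 (q ^ 3) ^ 5 * J_m 6 (q ^ 3) ^ 2 / (J_m 2 (q ^ 3) ^ 3 * J_m 3 (q ^ 3)))"
    "x \<in> {w, w ^ 2, - w, - (w ^ 2)} \<Longrightarrow> rank_class q w x = 6 * q * (J_m 3 (q ^ 3) * J_m 6 (q ^ 3) / J_m 1 (q ^ 3))"
proof -
  note w' = primitive_cube_root[OF w]
  note v = theta_reduced_values
  have J: "J_m k (q ^ 3) \<noteq> 0" if "k > 0" for k
    using qpoch_inf_Q_nonzero[OF that] by (simp add: J_m_def)
  have nz: "J_m 1 (q ^ 3) \<noteq> 0" "J_m 2 (q ^ 3) \<noteq> 0" "J_m 3 (q ^ 3) \<noteq> 0" "J_m 6 (q ^ 3) \<noteq> 0"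
    by (simp_all add: J)
  have w4: "w * w ^ 2 = 1" "w ^ 2 * w = 1" "w ^ 2 * w ^ 2 = w" "(w ^ 2) ^ 3 = 1" "w * w = w ^ 2"
    using w'(1) by (simp_all add: eval_nat_numeral mult_ac)
  have r: "rank_class q w x = 6 * q * (J_m 2 (q ^ 3) / J_m 1 (q ^ 3)) * J_m 3 (q ^ 3) *
     (theta_reduced (w * x) (q ^ 3) * theta_reduced (w ^ 2 * x) (q ^ 3) * theta_reduced (- x) (q ^ 3))
     / theta_reduced (x ^ 3) (q ^ 3)" if "norm x = 1" for x
    using rank_class_eq[OF that] by (simp only: v(7) J_m_def[of 3])
  \<comment> \<open>\<open>a\<close>, \<open>b\<close>, \<open>c\<close>, \<open>d\<close> stand for
    \<open>J_m\<close> with index 1, 2, 3, 6, and \<open>e\<close> for the theta value at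
    \<open>x ^ 3\<close>.\<close>
  have alg: "6 * q * (b / a) * c * ((c / a) * (c / a) * (b / a) ^ 2) / a ^ 2 = 6 * q * (b ^ 3 * c ^ 3 / a ^ 7)"
    "6 * q * (b / a) * c * ((d * a / (c * b)) * (d * a / (c * b)) * a ^ 2) / (b / a) ^ 2
      = 6 * q * (a ^ 5 * d ^ 2 / (b ^ 3 * c))"
    "6 * q * (b / a) * c * ((c / a) * e * (d * a / (c * b))) / e = 6 * q * (c * d / a)"
    if "a \<noteq> 0" "b \<noteq> 0" "c \<noteq> 0" "d \<noteq> 0" "e \<noteq> 0" for a b c d e
    using that by (simp_all add: field_simps eval_nat_numeral)
  show "rank_class q w 1 = 6 * q * (J_m 2 (q ^ 3) ^ 3 * J_m 3 (q ^ 3) ^ 3 / J_m 1 (q ^ 3) ^ 7)"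
    using r[of 1] alg(1)[OF nz(1-4) nz(1)] by (simp only: v norm_one mult_1_right power_one)
  have m: "w * - 1 = - w" "w ^ 2 * - 1 = - (w ^ 2)" "- (- 1 :: complex) = 1" "(- 1 :: complex) ^ 3 = - 1"
    "w * - w = - (w ^ 2)" "w ^ 2 * - w = - 1" "w * - (w ^ 2) = - 1" "w ^ 2 * - (w ^ 2) = - w"
    "(- w) ^ 3 = - 1" "(- (w ^ 2)) ^ 3 = - 1"
    using w4 w'(1) by simp_all
  show "rank_class q w (- 1) = 6 * q * (J_m 1 (q ^ 3) ^ 5 * J_m 6 (q ^ 3) ^ 2 / (J_m 2 (q ^ 3) ^ 3 * J_m 3 (q ^ 3)))"
    using r[of "- 1"] alg(2)[OF nz(1-4) nz(1)] by (simp only: v m norm_one norm_minus_cancel)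
  \<comment> \<open>At each of the four points one of the three theta arguments equals
    \<open>x ^ 3\<close>, so its value \<open>e\<close> cancels against the denominator.\<close>
  have core: "rank_class q w y = 6 * q * (J_m 3 (q ^ 3) * J_m 6 (q ^ 3) / J_m 1 (q ^ 3))"
    if "norm y = 1" "theta_reduced (y ^ 3) (q ^ 3) = e" "e \<noteq> 0"
      "theta_reduced (w * y) (q ^ 3) * theta_reduced (w ^ 2 * y) (q ^ 3) * theta_reduced (- y) (q ^ 3)
        = J_m 3 (q ^ 3) / J_m 1 (q ^ 3) * e * (J_m 6 (q ^ 3) * J_m 1 (q ^ 3) / (J_m 3 (q ^ 3) * J_m 2 (q ^ 3)))" for y e
    unfolding r[OF that(1)] that(2,4) by (rule alg(3)[OF nz that(3)])
  have e: "J_m 1 (q ^ 3) ^ 2 \<noteq> 0" "(J_m 2 (q ^ 3) / J_m 1 (q ^ 3)) ^ 2 \<noteq> 0"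
    using nz by simp_all
  have n: "norm w = 1" "norm (w ^ 2) = 1" "norm (- w) = 1" "norm (- (w ^ 2)) = 1"
    by (simp_all add: w' norm_power)
  have "rank_class q w w = 6 * q * (J_m 3 (q ^ 3) * J_m 6 (q ^ 3) / J_m 1 (q ^ 3))"
    by (rule core[OF n(1) _ e(1)]) (simp_all only: w4 w' v)
  moreover have "rank_class q w (w ^ 2) = 6 * q * (J_m 3 (q ^ 3) * J_m 6 (q ^ 3) / J_m 1 (q ^ 3))"
    by (rule core[OF n(2) _ e(1)], simp_all only: w4 w' v) (simp only: mult_ac)
  moreover have "rank_class q w (- w) = 6 * q * (J_m 3 (q ^ 3) * J_m 6 (q ^ 3) / J_m 1 (q ^ 3))"
    by (rule core[OF n(3) _ e(2)], simp_all only: m v minus_minus) (simp only: mult_ac)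
  moreover have "rank_class q w (- (w ^ 2)) = 6 * q * (J_m 3 (q ^ 3) * J_m 6 (q ^ 3) / J_m 1 (q ^ 3))"
    by (rule core[OF n(4) _ e(2)], simp_all only: m v minus_minus) (simp only: mult_ac)
  ultimately show "x \<in> {w, w ^ 2, - w, - (w ^ 2)} \<Longrightarrow>
      rank_class q w x = 6 * q * (J_m 3 (q ^ 3) * J_m 6 (q ^ 3) / J_m 1 (q ^ 3))"
    by blast
qed

end

section \<open>Extraction of residue classes by roots of unity\<close>

definition rank_poly :: "nat \<Rightarrow> complex \<Rightarrow> complex" where
  "rank_poly n x = (\<Sum>\<pi>\<in>overpartitions n. x powi (- overpartition_rank \<pi>))"

lemma has_sum_rank_poly:
  fixes q w x :: complex
  assumes q: "0 < norm q" "norm q < 1" and w: "w ^ 2 + w + 1 = 0" and x: "norm x = 1"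
  shows "((\<lambda>n. rank_poly (3 * n + 1) x * (q ^ 3) ^ n) has_sum (rank_class q w x / (3 * q))) UNIV"
proof -
  note w' = primitive_cube_root[OF w]
  have gf: "((\<lambda>n. rank_poly n x * r ^ n) has_sum (rank_num x r / qpoch_inf (r * x) r)) UNIV"
    if "norm r = norm q" for r
    using rank_generating_function[of r x] that q x by (simp add: rank_poly_def)
  have "((\<lambda>n. rank_poly n x * q ^ n + w ^ 2 * (rank_poly n x * (w * q) ^ n)
      + w ^ 4 * (rank_poly n x * (w ^ 2 * q) ^ n)) has_sum rank_class q w x) UNIV"
    unfolding rank_class_def cube_root_sum_expand
    by (intro has_sum_add has_sum_cmult_right gf) (use w' in \<open>auto simp: norm_mult norm_power\<close>)
  moreover have "rank_poly n x * q ^ n + w ^ 2 * (rank_poly n x * (w * q) ^ n)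
      + w ^ 4 * (rank_poly n x * (w ^ 2 * q) ^ n)
      = (if n \<in> range (\<lambda>k. 3 * k + 1) then 3 * (rank_poly n x * q ^ n) else 0)" for n
  proof -
    have e: "rank_poly n x * q ^ n + w ^ 2 * (rank_poly n x * (w * q) ^ n)
        + w ^ 4 * (rank_poly n x * (w ^ 2 * q) ^ n)
        = (1 + w ^ 2 * w ^ n + w ^ 4 * (w ^ n) ^ 2) * (rank_poly n x * q ^ n)"
      by (simp add: power_mult_distrib algebra_simps flip: power_mult)
    have m: "w ^ n = w ^ (n mod 3)"
    proof -
      have "w ^ n = w ^ (3 * (n div 3) + n mod 3)" by simp
      then show ?thesis unfolding power_add power_mult w' by simp
    qed
    have r: "n \<in> range (\<lambda>k. 3 * k + 1) \<longleftrightarrow> n mod 3 = 1"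
    proof
      assume "n mod 3 = 1"
      then have "n = 3 * (n div 3) + 1" by presburger
      then show "n \<in> range (\<lambda>k. 3 * k + 1)" by blast
    qed auto
    have p: "w ^ 4 = w" "w ^ 2 * w = 1" "w * w ^ 2 = 1" "w ^ 2 * w ^ 2 = w" "w * (w ^ 2) ^ 2 = w ^ 2"
    proof -
      have "w ^ 4 = w ^ 3 * w" "w ^ 2 * w = w ^ 3" "w * w ^ 2 = w ^ 3" "w ^ 2 * w ^ 2 = w ^ 3 * w"
        "w * (w ^ 2) ^ 2 = w ^ 3 * w ^ 2"
        by (simp_all flip: power_mult power_add power_Suc2 power_Suc)
      then show "w ^ 4 = w" "w ^ 2 * w = 1" "w * w ^ 2 = 1" "w ^ 2 * w ^ 2 = w" "w * (w ^ 2) ^ 2 = w ^ 2"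
        by (simp_all add: w'(1))
    qed
    have z: "1 + w ^ 2 + w = 0" "1 + w + w ^ 2 = 0" using w by (simp_all add: add_ac)
    \<comment> \<open>A sum of powers of \<open>w ^ (n + 2)\<close>, which equals 1 exactly for
      \<open>n mod 3 = 1\<close>.\<close>
    have "1 + w ^ 2 * w ^ n + w ^ 4 * (w ^ n) ^ 2 = (if n mod 3 = 1 then 3 else 0)"
    proof -
      consider "n mod 3 = 0" | "n mod 3 = 1" | "n mod 3 = 2" by linarith
      then show ?thesis
      proof cases
        case 1
        then have "w ^ n = 1" using m by simp
        then show ?thesis using 1 z by (simp add: p(1))
      next
        case 2
        then have "w ^ n = w" using m by simp
        then show ?thesis using 2 by (simp only: p) simp
      next
        case 3
        then have "w ^ n = w ^ 2" using m by simp
        then show ?thesis using 3 by (simp only: p z) simp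
      qed
    qed
    then show ?thesis unfolding e r by simp
  qed
  ultimately have "((\<lambda>n. if n \<in> range (\<lambda>k. 3 * k + 1) then 3 * (rank_poly n x * q ^ n) else 0)
      has_sum rank_class q w x) UNIV"
    by simp
  then have "((\<lambda>n. 3 * (rank_poly n x * q ^ n)) has_sum rank_class q w x) (range (\<lambda>k. 3 * k + 1))"
    by (rule has_sum_cong_neutral[THEN iffD1, rotated -1]) auto
  then have "((\<lambda>k. 3 * (rank_poly (3 * k + 1) x * q ^ (3 * k + 1))) has_sum rank_class q w x) UNIV"
    by (subst (asm) has_sum_reindex) (auto simp: inj_on_def o_def)
  from has_sum_cmult_left[OF this, of "1 / (3 * q)"]
  have "((\<lambda>k. 3 * (rank_poly (3 * k + 1) x * q ^ (3 * k + 1)) * (1 / (3 * q)))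
      has_sum (rank_class q w x * (1 / (3 * q)))) UNIV" .
  moreover have "3 * (rank_poly (3 * k + 1) x * q ^ (3 * k + 1)) * (1 / (3 * q))
      = rank_poly (3 * k + 1) x * (q ^ 3) ^ k" for k
    using q by (simp add: power_mult)
  ultimately show ?thesis by simp
qed

text \<open>The assumption makes \<open>z\<close> a primitive sixth root of unity. The summand is
  the \<open>k\<close>-th power of \<open>z powi (int s - t)\<close>, so the geometric sum vanishes
  unless this base is 1.\<close>

lemma sum_sixth_roots:
  fixes z :: complex
  assumes z: "z ^ 2 - z + 1 = 0"
  shows "(\<Sum>k<6. z ^ (k * s) * (z ^ k) powi (- t)) = (if [t = int s] (mod 6) then 6 else 0)"
proof -
  have z3: "z ^ 3 = - 1" using z by algebra
  then have z0: "z \<noteq> 0" by auto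
  have z6: "z ^ 6 = 1" using arg_cong[OF z3, of "\<lambda>t. t ^ 2"] by (simp flip: power_mult)
  define u where "u = z powi (int s - t)"
  have "z ^ (k * s) * (z ^ k) powi (- t) = u ^ k" for k
  proof -
    have "(z ^ k) powi (- t) = (z powi (- t)) ^ k"
      by (metis mult.commute power_int_mult power_int_of_nat)
    moreover have "z ^ (k * s) = (z ^ s) ^ k" by (simp flip: power_mult add: mult.commute)
    moreover have "u = z ^ s * z powi (- t)"
      using z0 unfolding u_def diff_conv_add_uminus by (subst power_int_add) auto
    ultimately show ?thesis by (simp add: power_mult_distrib)
  qed
  then have s: "(\<Sum>k<6. z ^ (k * s) * (z ^ k) powi (- t)) = (\<Sum>k<6. u ^ k)" by simp
  define m where "m = nat ((int s - t) mod 6)"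
  have "u = z powi (6 * ((int s - t) div 6) + int m)" by (simp add: u_def m_def)
  also have "\<dots> = z ^ m"
    using z0 z6 by (simp add: power_int_add power_int_mult)
  finally have um: "u = z ^ m" .
  have "m < 6" by (simp add: m_def nat_less_iff)
  have cong: "[t = int s] (mod 6) \<longleftrightarrow> m = 0"
  proof -
    have "[t = int s] (mod 6) \<longleftrightarrow> (int s - t) mod 6 = 0"
      by (metis cong_iff_dvd_diff cong_sym_eq dvd_eq_mod_eq_0)
    then show ?thesis unfolding m_def by auto
  qed
  show ?thesis
  proof (cases "m = 0")
    case True
    then show ?thesis using cong by (simp add: s um)
  next
    case False
    have "u \<noteq> 1"
    proof
      assume u1: "u = 1"
      have "m \<in> {1, 2, 3, 4, 5}" using False \<open>m < 6\<close> by auto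
      moreover have "z \<noteq> 1" "z ^ 2 \<noteq> 1" "z ^ 4 \<noteq> 1" "z ^ 5 \<noteq> 1"
      proof -
        have "z ^ 2 = z - 1" using z by algebra
        moreover have "z ^ 4 = - z" "z ^ 5 = - (z ^ 2)"
          using z3 by (simp_all add: eval_nat_numeral)
        moreover have "- z \<noteq> 1"
        proof
          assume "- z = 1"
          then have "z = - 1" by (metis minus_minus)
          then show False using z by simp
        qed
        ultimately show "z \<noteq> 1" "z ^ 2 \<noteq> 1" "z ^ 4 \<noteq> 1" "z ^ 5 \<noteq> 1"
          using z3 z by auto
      qed
      ultimately show False using u1 um z3 by auto
    qed
    moreover have "u ^ 6 = 1"
      unfolding um using z6 by (metis mult.commute power_mult power_one)
    ultimately have "(\<Sum>k<6. u ^ k) = 0" by (simp add: geometric_sum)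
    with False cong show ?thesis by (simp add: s)
  qed
qed

lemma Nbar_eq_rank_poly:
  assumes "z ^ 2 - z + 1 = (0 :: complex)"
  shows "of_nat (Nbar (int s) 6 n) = (\<Sum>k<6. z ^ (k * s) * rank_poly n (z ^ k)) / 6"
proof -
  have "(\<Sum>k<6. z ^ (k * s) * rank_poly n (z ^ k))
      = (\<Sum>\<pi>\<in>overpartitions n. \<Sum>k<6. z ^ (k * s) * (z ^ k) powi (- overpartition_rank \<pi>))"
    unfolding rank_poly_def sum_distrib_left by (rule sum.swap)
  also have "\<dots> = (\<Sum>\<pi>\<in>overpartitions n. if [overpartition_rank \<pi> = int s] (mod 6) then 6 else 0)"
    by (simp only: sum_sixth_roots[OF assms])
  also have "\<dots> = 6 * of_nat (Nbar (int s) 6 n)"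
    by (simp add: Nbar_def finite_overpartitions Int_def flip: sum.inter_filter)
  finally show ?thesis by simp
qed

lemma has_sum_sum:
  fixes f :: "'i \<Rightarrow> 'b \<Rightarrow> 'a :: topological_comm_monoid_add"
  assumes "\<And>i. i \<in> I \<Longrightarrow> (f i has_sum g i) A"
  shows "((\<lambda>n. \<Sum>i\<in>I. f i n) has_sum (\<Sum>i\<in>I. g i)) A"
  using assms by (induction I rule: infinite_finite_induct) (auto intro!: has_sum_add)

text \<open>\<open>z\<close> is a primitive sixth root of unity. The 18 combines the 6 of the
  residue filter for the rank with the 3 of the cube-root filter for the exponent.\<close>

lemma has_sum_rbar_term:
  assumes q: "0 < norm q" "norm q < 1" and w: "w ^ 2 + w + 1 = 0" and z: "z = - (w ^ 2)"
  shows "(rbar_term (int s) 1 (q ^ 3) has_sum (\<Sum>k<6. z ^ (k * s) * rank_class q w (z ^ k)) / (18 * q)) UNIV"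
proof -
  have z1: "z ^ 2 - z + 1 = 0" using w z by algebra
  have "norm z = 1" using primitive_cube_root(2)[OF w] by (simp add: z norm_power)
  then have nz: "norm (z ^ k) = 1" for k by (simp add: norm_power)
  have "((\<lambda>n. \<Sum>k<6. z ^ (k * s) * (rank_poly (3 * n + 1) (z ^ k) * (q ^ 3) ^ n))
      has_sum (\<Sum>k<6. z ^ (k * s) * (rank_class q w (z ^ k) / (3 * q)))) UNIV"
    by (intro has_sum_sum has_sum_cmult_right has_sum_rank_poly q w nz)
  from has_sum_cmult_right[OF this, of "1 / 6"]
  have "((\<lambda>n. 1 / 6 * (\<Sum>k<6. z ^ (k * s) * (rank_poly (3 * n + 1) (z ^ k) * (q ^ 3) ^ n)))
      has_sum (1 / 6 * (\<Sum>k<6. z ^ (k * s) * (rank_class q w (z ^ k) / (3 * q))))) UNIV" .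
  moreover have "1 / 6 * (\<Sum>k<6. z ^ (k * s) * (rank_class q w (z ^ k) / (3 * q)))
      = (\<Sum>k<6. z ^ (k * s) * rank_class q w (z ^ k)) / (18 * q)"
    by (simp add: sum_divide_distrib sum_distrib_left mult_ac)
  moreover have "1 / 6 * (\<Sum>k<6. z ^ (k * s) * (rank_poly (3 * n + 1) (z ^ k) * (q ^ 3) ^ n))
      = rbar_term (int s) 1 (q ^ 3) n" for n
    unfolding rbar_term_def Nbar_eq_rank_poly[OF z1] by (simp add: sum_distrib_left sum_distrib_right sum_divide_distrib mult_ac)
  ultimately show ?thesis by simp
qed

section \<open>Theta products to the modulus 6 and final assembly\<close>

lemma J_am_eq:
  assumes q: "0 < norm q" "norm q < 1"
  shows "J_am 1 6 q = J_m 1 q * J_m 6 q ^ 2 / (J_m 2 q * J_m 3 q)"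
    and "J_am 3 6 q = J_m 3 q ^ 2 / J_m 6 q"
    and "k > 0 \<Longrightarrow> J_m k q \<noteq> 0"
proof -
  \<comment> \<open>Every product involved is a monomial in these residue products modulo 6.\<close>
  define a where "a i = qpoch_inf (q ^ i) (q ^ 6)" for i
  have nk: "norm (q ^ k) < 1" if "k > 0" for k
    using q that by (simp add: norm_power power_less_one_iff)
  have nz: "a i \<noteq> 0" if "i > 0" for i
    unfolding a_def using nk that by (intro qpoch_inf_nonzero_norm) auto
  show "J_m k q \<noteq> 0" if "k > 0" for k
    unfolding J_m_def using nk[OF that] by (rule qpoch_inf_nonzero_norm) (use nk that in auto)
  have J: "J_m 1 q = a 1 * a 2 * a 3 * a 4 * a 5 * a 6" "J_m 2 q = a 2 * a 4 * a 6"
    "J_m 3 q = a 3 * a 6" "J_m 6 q = a 6"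
    using qpoch_inf_dissect[OF nk[of 1], of 6 q] qpoch_inf_dissect[OF nk[of 2], of 3 "q ^ 2"]
      qpoch_inf_dissect[OF nk[of 3], of 2 "q ^ 3"]
    by (simp_all add: J_m_def a_def lessThan_Suc eval_nat_numeral mult_ac)
  have "q ^ 6 / q ^ 1 = q ^ 5" "q ^ 6 / q ^ 3 = q ^ 3"
    using q by (simp_all add: field_simps flip: power_add power_Suc)
  then have A: "J_am 1 6 q = a 1 * a 5 * a 6" "J_am 3 6 q = a 3 * a 3 * a 6"
    unfolding J_am_def theta_j_def a_def by simp_all
  show "J_am 1 6 q = J_m 1 q * J_m 6 q ^ 2 / (J_m 2 q * J_m 3 q)"
    "J_am 3 6 q = J_m 3 q ^ 2 / J_m 6 q"
    unfolding A J using nz[of 2] nz[of 3] nz[of 4] nz[of 6] by (simp_all add: power2_eq_square)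
qed

theorem theorem5p8:
  fixes q :: complex
  assumes "0 < norm q" and "norm q < 1"
  shows "(\<forall>s \<in> {0, 1, 2, 3}. summable (rbar_term s 1 q)) \<and>
    rbar 0 1 q =
        J_m 6 q ^ 12 / (3 * J_am 1 6 q ^ 7 * J_m 2 q ^ 4 * J_am 3 6 q ^ 2)
        + 4 * J_m 6 q ^ 3 / (3 * J_am 1 6 q * J_m 2 q)
        + J_am 1 6 q ^ 5 * J_m 2 q ^ 2 * J_am 3 6 q ^ 2 / (3 * J_m 6 q ^ 6) \<and>
    rbar 1 1 q =
        J_m 6 q ^ 12 / (3 * J_am 1 6 q ^ 7 * J_m 2 q ^ 4 * J_am 3 6 q ^ 2)
        - J_am 1 6 q ^ 5 * J_m 2 q ^ 2 * J_am 3 6 q ^ 2 / (3 * J_m 6 q ^ 6) \<and>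
    rbar 2 1 q =
        J_m 6 q ^ 12 / (3 * J_am 1 6 q ^ 7 * J_m 2 q ^ 4 * J_am 3 6 q ^ 2)
        - 2 * J_m 6 q ^ 3 / (3 * J_am 1 6 q * J_m 2 q)
        + J_am 1 6 q ^ 5 * J_m 2 q ^ 2 * J_am 3 6 q ^ 2 / (3 * J_m 6 q ^ 6) \<and>
    rbar 3 1 q =
        J_m 6 q ^ 12 / (3 * J_am 1 6 q ^ 7 * J_m 2 q ^ 4 * J_am 3 6 q ^ 2)
        - J_am 1 6 q ^ 5 * J_m 2 q ^ 2 * J_am 3 6 q ^ 2 / (3 * J_m 6 q ^ 6)"
proof -
  \<comment> \<open>The filtered series come out in the cube of their nome, so a cube root of
    \<open>q\<close> is taken as nome.\<close>
  define p where "p = exp (Ln q / 3)"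
  have "q \<noteq> 0" using assms by auto
  then have p3: "p ^ 3 = q" by (simp add: p_def flip: exp_of_nat_mult)
  then have "norm p ^ 3 = norm q" by (simp flip: norm_power)
  with assms have p: "0 < norm p" "norm p < 1"
    by (auto simp: p_def power_less_one_iff[of "norm p" 3, symmetric])
  define w where "w = Complex (- 1 / 2) (sqrt 3 / 2)"
  have w: "w ^ 2 + w + 1 = 0"
    by (simp add: w_def complex_eq_iff power2_eq_square)
  define z where "z = - (w ^ 2)"
  have w3: "w ^ 3 = 1" by (rule primitive_cube_root[OF w])
  have w2: "w ^ 2 = - 1 - w" using w by algebra
  \<comment> \<open>Up to the factor \<open>6 * p\<close>, the values of
    \<open>rank_class p w\<close> at 1, at \<open>- 1\<close> and at the other four sixth roots of
    unity.\<close>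
  define A B C where "A = J_m 2 q ^ 3 * J_m 3 q ^ 3 / J_m 1 q ^ 7"
    and "B = J_m 1 q ^ 5 * J_m 6 q ^ 2 / (J_m 2 q ^ 3 * J_m 3 q)"
    and "C = J_m 3 q * J_m 6 q / J_m 1 q"
  have zk: "z ^ 0 = 1" "z ^ 1 = - (w ^ 2)" "z ^ 2 = w" "z ^ 3 = - 1" "z ^ 4 = w ^ 2" "z ^ 5 = - w"
    using w3 by (simp_all add: z_def eval_nat_numeral mult_ac)
  have zz: "z ^ (k + 6) = z ^ k" for k
  proof -
    have "z ^ 6 = (z ^ 3) ^ 2" by (simp flip: power_mult)
    then show ?thesis by (simp add: power_add zk)
  qed
  note v = rank_class_values[OF p w, unfolded p3, folded A_def B_def C_def]
  have R: "rank_class p w 1 = 6 * p * A" "rank_class p w (- 1) = 6 * p * B"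
    "rank_class p w w = 6 * p * C" "rank_class p w (w ^ 2) = 6 * p * C"
    "rank_class p w (- w) = 6 * p * C" "rank_class p w (- (w ^ 2)) = 6 * p * C"
    using v by auto
  have S: "(rbar_term (int s) 1 q has_sum (A + z ^ (3 * s) * B + (z ^ s + z ^ (2 * s) + z ^ (4 * s) + z ^ (5 * s)) * C) / 3) UNIV" for s
  proof -
    have e: "(\<Sum>k<6. z ^ (k * s) * rank_class p w (z ^ k)) / (18 * p)
       = (A + z ^ (3 * s) * B + (z ^ s + z ^ (2 * s) + z ^ (4 * s) + z ^ (5 * s)) * C) / 3"
    proof -
      have "{..<6} = {0, 1, 2, 3, 4, 5 :: nat}" by auto
      then have "(\<Sum>k<6. z ^ (k * s) * rank_class p w (z ^ k))
         = 6 * p * (A + z ^ (3 * s) * B + (z ^ s + z ^ (2 * s) + z ^ (4 * s) + z ^ (5 * s)) * C)"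
        using zk by (simp add: R algebra_simps)
      then show ?thesis using p by simp
    qed
    show ?thesis using has_sum_rbar_term[OF p w z_def, of s] unfolding p3 e .
  qed
  have sums: "rbar_term (int s) 1 q sums
      ((A + z ^ (3 * s) * B + (z ^ s + z ^ (2 * s) + z ^ (4 * s) + z ^ (5 * s)) * C) / 3)" for s
    using S by (rule has_sum_imp_sums)
  have z6: "z ^ 6 = 1" "z ^ 8 = z ^ 2" "z ^ 9 = z ^ 3" "z ^ 10 = z ^ 4" "z ^ 12 = 1" "z ^ 15 = z ^ 3"
    using zz[of 0] zz[of 2] zz[of 3] zz[of 4] zz[of 6] zz[of 9] by simp_all
  have val: "rbar_term 0 1 q sums (A / 3 + 4 * C / 3 + B / 3)" "rbar_term 1 1 q sums (A / 3 - B / 3)"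
    "rbar_term 2 1 q sums (A / 3 - 2 * C / 3 + B / 3)" "rbar_term 3 1 q sums (A / 3 - B / 3)"
  proof -
    show "rbar_term 0 1 q sums (A / 3 + 4 * C / 3 + B / 3)"
      using sums[of 0] by (simp add: add_divide_distrib add_ac)
    show "rbar_term 1 1 q sums (A / 3 - B / 3)"
      using sums[of 1] zk by (simp add: w2 diff_divide_distrib)
    show "rbar_term 2 1 q sums (A / 3 - 2 * C / 3 + B / 3)"
      using sums[of 2] zk by (simp add: z6 w2 diff_divide_distrib add_divide_distrib algebra_simps)
    show "rbar_term 3 1 q sums (A / 3 - B / 3)"
      using sums[of 3] zk by (simp add: z6 w2 diff_divide_distrib)
  qed
  note j = J_am_eq[OF assms]
  have nz: "J_m 1 q \<noteq> 0" "J_m 2 q \<noteq> 0" "J_m 3 q \<noteq> 0" "J_m 6 q \<noteq> 0"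
    by (simp_all add: j(3))
  \<comment> \<open>With \<open>J_am\<close> rewritten through \<open>J_m\<close>, the three
    quotients of the theorem are \<open>A / 3\<close>, \<open>C / 3\<close> and
    \<open>B / 3\<close>, in this order.\<close>
  have alg: "d ^ 12 / (3 * (a * d ^ 2 / (b * c)) ^ 7 * b ^ 4 * (c ^ 2 / d) ^ 2) = (b ^ 3 * c ^ 3 / a ^ 7) / 3"
    "d ^ 3 / (3 * (a * d ^ 2 / (b * c)) * b) = (c * d / a) / 3"
    "(a * d ^ 2 / (b * c)) ^ 5 * b ^ 2 * (c ^ 2 / d) ^ 2 / (3 * d ^ 6) = (a ^ 5 * d ^ 2 / (b ^ 3 * c)) / 3"
    if "a \<noteq> 0" "b \<noteq> 0" "c \<noteq> 0" "d \<noteq> 0" for a b c d :: complex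
    using that by (simp_all add: field_simps power_mult_distrib eval_nat_numeral)
  note alg' = alg[OF nz, folded A_def B_def C_def j(1,2)]
  have C: "x * J_m 6 q ^ 3 / (3 * J_am 1 6 q * J_m 2 q) = x * C / 3" for x
    using alg'(2) by (metis times_divide_eq_right)
  show ?thesis
    unfolding alg' C rbar_def using val by (auto simp: sums_iff)
qed

end
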